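(* Any nondegenerate W-stationary point of MPSC is strongly stable.
   Context: Setting. Let $I,J$ be finite index sets, and let $f\in C^2(\mathbb{R}^n,\mathbb{R})$, $h\in C^2(\mathbb{R}^n,\mathbb{R}^{|I|})$, $g\in C^2(\mathbb{R}^n,\mathbb{R}^{|J|})$, $F_1,F_2\in C^2(\mathbb{R}^n,\mathbb{R}^k)$. The mathematical program with switching constraints MPSC$[f,h,g,F_1,F_2]$ is to minimize $f(x)$ subject to $x\in M$, where $M=\{x\in\mathbb{R}^n \mid h_i(x)=0\ (i\in I),\ g_j(x)\ge 0\ (j\in J),\ F_{1,m}(x)F_{2,m}(x)=0\ (m=1,\dots,k)\}$. Index sets at $\bar x\in M$: $J_0(\bar x)=\{j\in J\mid g_j(\bar x)=0\}$; $\alpha(\bar x)=\{m\mid F_{1,m}(\bar x)=0, F_{2,m}(\bar x)\ne 0\}$; $\beta(\bar x)=\{m\mid F_{1,m}(\bar x)=F_{2,m}(\bar x)=0\}$; $\gamma(\bar x)=\{m\mid F_{1,m}(\bar x)\ne 0, F_{2,m}(\bar x)=0\}$. LICQ holds at $\bar x\in M$ if the vectors $Dh_i(\bar x)$ ($i\in I$), $DF_{1,m}(\bar x)$ ($m\in\alpha(\bar x)$), $DF_{2,m}(\bar x)$ ($m\in\gamma(\bar x)$), $Dg_j(\bar x)$ ($j\in J_0(\bar x)$), $DF_{1,m}(\bar x), DF_{2,m}(\bar x)$ ($m\in\beta(\bar x)$) are linearly independent. W-stationarity: $\bar x\in M$ is W-stationary if there are real multipliers $\bar\lambda_i$ ($i\in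 I$), $\bar\mu_j$ ($j\in J$), $\bar\sigma_{1,m},\bar\sigma_{2,m}$ ($m=1,\dots,k$) such that $Df(\bar x)=\sum_{i\in I}\bar\lambda_i Dh_i(\bar x)+\sum_{j\in J}\bar\mu_j Dg_j(\bar x)+\sum_{m=1}^k(\bar\sigma_{1,m}DF_{1,m}(\bar x)+\bar\sigma_{2,m}DF_{2,m}(\bar x))$, $\bar\mu_j g_j(\bar x)=0$ and $\bar\mu_j\ge 0$ for all $j\in J$, and $\bar\sigma_{l,m}F_{l,m}(\bar x)=0$ for $l=1,2$, $m=1,\dots,k$. Under LICQ the multipliers are unique. Lagrange function: $L(x,\lambda,\mu,\sigma)=f(x)-\sum_{i\in I}\lambda_i h_i(x)-\sum_{j\in J}\mu_j g_j(x)-\sum_{m=1}^k(\sigma_{1,m}F_{1,m}(x)+\sigma_{2,m}F_{2,m}(x))$. Tangent space: $T_{\bar x}M_0(\bar x)=\{\xi\in\mathbb{R}^n\mid Dh_i(\bar x)\xi=0\ (i\in I),\ Dg_j(\bar x)\xi=0\ (j\in J_0(\bar x)),\ DF_{1,m}(\bar x)\xi=0\ (m\in\alpha(\bar x)),\ DF_{2,m}(\bar x)\xi=0\ (m\in\gamma(\bar x)),\ DF_{1,m}(\bar x)\xi=DF_{2,m}(\bar x)\xi=0\ (m\in\beta(\bar x))\}$. The restriction of $D^2_{xx}L$ to this space means $V^T D^2_{xx}L\,V$, where the columns of $V$ form a basis of the space. Nondegeneracy: a W-stationary point $\bar x$ with multipliers $(\bar\lambda,\bar\mu,\bar\sigma)$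 is nondegenerate if ND1: LICQ holds at $\bar x$; ND2: $\bar\mu_j>0$ for all $j\in J_0(\bar x)$; ND3: $\bar\sigma_{1,m}\bar\sigma_{2,m}\ne 0$ for all $m\in\beta(\bar x)$; ND4: $D^2_{xx}L(\bar x,\bar\lambda,\bar\mu,\bar\sigma)$ restricted to $T_{\bar x}M_0(\bar x)$ is nonsingular. Strong stability: let $B(\bar x,r)=\{x\in\mathbb{R}^n\mid\|x-\bar x\|\le r\}$ and let $\|(f,h,g,F_1,F_2)\|^{C^2}_{B(\bar x,r)}$ be the maximum modulus, over $B(\bar x,r)$, of the function values and partial derivatives up to order two of (all components of) $f,h,g,F_1,F_2$. A W-stationary point $\bar x$ for MPSC$[f,h,g,F_1,F_2]$ is called strongly stable if for some $r>0$ and each $\varepsilon\in(0,r]$ there exists $\delta=\delta(\varepsilon)>0$ such that whenever $\widetilde f,\widetilde h,\widetilde g,\widetilde F_1,\widetilde F_2$ are $C^2$ functions (with the same domains and codomains) with $\|(f-\widetilde f,h-\widetilde h,g-\widetilde g,F_1-\widetilde F_1,F_2-\widetilde F_2)\|^{C^2}_{B(\bar x,r)}\le\delta$, the ball $B(\bar x,\varepsilon)$ contains a W-stationary point $\widetilde x$ for MPSC$[\widetilde f,\widetilde h,\widetilde g,\widetilde F_1,\widetilde F_2]$ which is unique in $B(\bar x,r)$ (i.e. the only W-stationary point of the perturbed problem in $B(\bar x,r)$). *)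

theory Defs
  imports "HOL-Analysis.Analysis" "Jordan_Normal_Form.Matrix"
begin

(* Both imports claim these infixes; here they always mean the HOL-Analysis operations. *)
no_notation Matrix.scalar_prod (infix \<open>\<bullet>\<close> 70)
no_notation Matrix.vec_index (infixl \<open>$\<close> 100)

definition partial_deriv :: "'n::finite \<Rightarrow> (real^'n \<Rightarrow> real) \<Rightarrow> real^'n \<Rightarrow> real" where
  "partial_deriv a \<phi> x = frechet_derivative \<phi> (at x) (axis a 1)"

(* Continuity of \<phi> and of its first partials is implied by their differentiability. *)
definition C2 :: "(real^'n::finite \<Rightarrow> real) \<Rightarrow> bool" where
  "C2 \<phi> \<longleftrightarrow> \<phi> differentiable_on UNIV \<and>
     (\<forall>a. partial_deriv a \<phi> differentiable_on UNIV) \<and>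
     (\<forall>a b. continuous_on UNIV (partial_deriv b (partial_deriv a \<phi>)))"

definition grad :: "(real^'n::finite \<Rightarrow> real) \<Rightarrow> real^'n \<Rightarrow> real^'n" where
  "grad \<phi> x = (\<chi> a. partial_deriv a \<phi> x)"

definition hessian :: "(real^'n::finite \<Rightarrow> real) \<Rightarrow> real^'n \<Rightarrow> real^'n^'n" where
  "hessian \<phi> x = (\<chi> a b. partial_deriv a (partial_deriv b \<phi>) x)"

(* The index sets I, J and {1..k} are separate parameters of the definitions below, so that
   they may be empty; the values of the component functions, and of multipliers, at indices
   outside these sets are irrelevant. *)
record ('n::finite, 'i, 'j) mpsc =
  obj :: "real^'n \<Rightarrow> real"
  eqs :: "'i \<Rightarrow> real^'n \<Rightarrow> real"
  ineqs :: "'j \<Rightarrow> real^'n \<Rightarrow> real"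
  sw1 :: "nat \<Rightarrow> real^'n \<Rightarrow> real"
  sw2 :: "nat \<Rightarrow> real^'n \<Rightarrow> real"

definition mpsc_diff ::
  "('n::finite, 'i, 'j) mpsc \<Rightarrow> ('n, 'i, 'j) mpsc \<Rightarrow> ('n, 'i, 'j) mpsc" where
  "mpsc_diff P Q =
    \<lparr> obj = (\<lambda>x. obj P x - obj Q x),
      eqs = (\<lambda>i x. eqs P i x - eqs Q i x),
      ineqs = (\<lambda>j x. ineqs P j x - ineqs Q j x),
      sw1 = (\<lambda>m x. sw1 P m x - sw1 Q m x),
      sw2 = (\<lambda>m x. sw2 P m x - sw2 Q m x) \<rparr>"

definition components ::
  "'i set \<Rightarrow> 'j set \<Rightarrow> nat \<Rightarrow> ('n::finite, 'i, 'j) mpsc \<Rightarrow> (real^'n \<Rightarrow> real) set" where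
  "components I J k P =
     {obj P} \<union> eqs P ` I \<union> ineqs P ` J \<union> sw1 P ` {1..k} \<union> sw2 P ` {1..k}"

definition C2_mpsc ::
  "'i set \<Rightarrow> 'j set \<Rightarrow> nat \<Rightarrow> ('n::finite, 'i, 'j) mpsc \<Rightarrow> bool" where
  "C2_mpsc I J k P \<longleftrightarrow> (\<forall>\<phi>\<in>components I J k P. C2 \<phi>)"

definition feasible_set ::
  "'i set \<Rightarrow> 'j set \<Rightarrow> nat \<Rightarrow> ('n::finite, 'i, 'j) mpsc \<Rightarrow> (real^'n) set" where
  "feasible_set I J k P =
     {x. (\<forall>i\<in>I. eqs P i x = 0) \<and> (\<forall>j\<in>J. ineqs P j x \<ge> 0) \<and>
         (\<forall>m\<in>{1..k}. sw1 P m x * sw2 P m x = 0)}"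

definition J0 :: "'j set \<Rightarrow> ('n::finite, 'i, 'j) mpsc \<Rightarrow> real^'n \<Rightarrow> 'j set" where
  "J0 J P x = {j\<in>J. ineqs P j x = 0}"

definition alpha_set :: "nat \<Rightarrow> ('n::finite, 'i, 'j) mpsc \<Rightarrow> real^'n \<Rightarrow> nat set" where
  "alpha_set k P x = {m\<in>{1..k}. sw1 P m x = 0 \<and> sw2 P m x \<noteq> 0}"

definition beta_set :: "nat \<Rightarrow> ('n::finite, 'i, 'j) mpsc \<Rightarrow> real^'n \<Rightarrow> nat set" where
  "beta_set k P x = {m\<in>{1..k}. sw1 P m x = 0 \<and> sw2 P m x = 0}"

definition gamma_set :: "nat \<Rightarrow> ('n::finite, 'i, 'j) mpsc \<Rightarrow> real^'n \<Rightarrow> nat set" where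
  "gamma_set k P x = {m\<in>{1..k}. sw1 P m x \<noteq> 0 \<and> sw2 P m x = 0}"

datatype ('i, 'j) con = Eq 'i | Ineq 'j | Sw1 nat | Sw2 nat

fun con_fun :: "('n::finite, 'i, 'j) mpsc \<Rightarrow> ('i, 'j) con \<Rightarrow> real^'n \<Rightarrow> real" where
  "con_fun P (Eq i) = eqs P i"
| "con_fun P (Ineq j) = ineqs P j"
| "con_fun P (Sw1 m) = sw1 P m"
| "con_fun P (Sw2 m) = sw2 P m"

definition active_cons ::
  "'i set \<Rightarrow> 'j set \<Rightarrow> nat \<Rightarrow> ('n::finite, 'i, 'j) mpsc \<Rightarrow> real^'n \<Rightarrow> ('i, 'j) con set" where
  "active_cons I J k P x =
     Eq ` I \<union> Sw1 ` alpha_set k P x \<union> Sw2 ` gamma_set k P x \<union> Ineq ` J0 J P x \<union>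
     Sw1 ` beta_set k P x \<union> Sw2 ` beta_set k P x"

(* Linear independence is that of the family of gradients, hence the injectivity:
   coinciding gradients of two active constraints violate LICQ. *)
definition LICQ ::
  "'i set \<Rightarrow> 'j set \<Rightarrow> nat \<Rightarrow> ('n::finite, 'i, 'j) mpsc \<Rightarrow> real^'n \<Rightarrow> bool" where
  "LICQ I J k P x \<longleftrightarrow>
     inj_on (\<lambda>c. grad (con_fun P c) x) (active_cons I J k P x) \<and>
     independent ((\<lambda>c. grad (con_fun P c) x) ` active_cons I J k P x)"

definition W_stationary_with ::
  "'i set \<Rightarrow> 'j set \<Rightarrow> nat \<Rightarrow> ('n::finite, 'i, 'j) mpsc \<Rightarrow> real^'n \<Rightarrow>
   ('i \<Rightarrow> real) \<Rightarrow> ('j \<Rightarrow> real) \<Rightarrow> (nat \<Rightarrow> real) \<Rightarrow> (nat \<Rightarrow> real) \<Rightarrow> bool" where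
  "W_stationary_with I J k P x lam \<mu> \<sigma>1 \<sigma>2 \<longleftrightarrow>
     x \<in> feasible_set I J k P \<and>
     grad (obj P) x =
       (\<Sum>i\<in>I. lam i *\<^sub>R grad (eqs P i) x) + (\<Sum>j\<in>J. \<mu> j *\<^sub>R grad (ineqs P j) x) +
       (\<Sum>m=1..k. \<sigma>1 m *\<^sub>R grad (sw1 P m) x + \<sigma>2 m *\<^sub>R grad (sw2 P m) x) \<and>
     (\<forall>j\<in>J. \<mu> j * ineqs P j x = 0 \<and> \<mu> j \<ge> 0) \<and>
     (\<forall>m\<in>{1..k}. \<sigma>1 m * sw1 P m x = 0 \<and> \<sigma>2 m * sw2 P m x = 0)"

definition W_stationary ::
  "'i set \<Rightarrow> 'j set \<Rightarrow> nat \<Rightarrow> ('n::finite, 'i, 'j) mpsc \<Rightarrow> real^'n \<Rightarrow> bool" where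
  "W_stationary I J k P x \<longleftrightarrow> (\<exists>lam \<mu> \<sigma>1 \<sigma>2. W_stationary_with I J k P x lam \<mu> \<sigma>1 \<sigma>2)"

definition Lagrangian ::
  "'i set \<Rightarrow> 'j set \<Rightarrow> nat \<Rightarrow> ('n::finite, 'i, 'j) mpsc \<Rightarrow>
   ('i \<Rightarrow> real) \<Rightarrow> ('j \<Rightarrow> real) \<Rightarrow> (nat \<Rightarrow> real) \<Rightarrow> (nat \<Rightarrow> real) \<Rightarrow> real^'n \<Rightarrow> real" where
  "Lagrangian I J k P lam \<mu> \<sigma>1 \<sigma>2 x =
     obj P x - (\<Sum>i\<in>I. lam i * eqs P i x) - (\<Sum>j\<in>J. \<mu> j * ineqs P j x) -
     (\<Sum>m=1..k. \<sigma>1 m * sw1 P m x + \<sigma>2 m * sw2 P m x)"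

definition tangent_space ::
  "'i set \<Rightarrow> 'j set \<Rightarrow> nat \<Rightarrow> ('n::finite, 'i, 'j) mpsc \<Rightarrow> real^'n \<Rightarrow> (real^'n) set" where
  "tangent_space I J k P x =
     {\<xi>. (\<forall>i\<in>I. grad (eqs P i) x \<bullet> \<xi> = 0) \<and>
         (\<forall>j\<in>J0 J P x. grad (ineqs P j) x \<bullet> \<xi> = 0) \<and>
         (\<forall>m\<in>alpha_set k P x. grad (sw1 P m) x \<bullet> \<xi> = 0) \<and>
         (\<forall>m\<in>gamma_set k P x. grad (sw2 P m) x \<bullet> \<xi> = 0) \<and>
         (\<forall>m\<in>beta_set k P x. grad (sw1 P m) x \<bullet> \<xi> = 0 \<and> grad (sw2 P m) x \<bullet> \<xi> = 0)}"

definition is_basis_list :: "(real^'n::finite) list \<Rightarrow> (real^'n) set \<Rightarrow> bool" where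
  "is_basis_list vs T \<longleftrightarrow> distinct vs \<and> independent (set vs) \<and> span (set vs) = T"

(* The matrix V\<^sup>T H V, where V has the columns vs. Its size depends on the point at hand,
   so it has to be a matrix with explicit dimensions. *)
definition restricted_matrix :: "real^'n::finite^'n \<Rightarrow> (real^'n) list \<Rightarrow> real Matrix.mat" where
  "restricted_matrix H vs =
     Matrix.mat (length vs) (length vs) (\<lambda>(a, b). (vs ! a) \<bullet> (H *v (vs ! b)))"

(* The choice of the basis vs is immaterial. The 0 \<times> 0 matrix, which occurs for a trivial
   tangent space, is invertible. *)
definition nonsingular_on :: "real^'n::finite^'n \<Rightarrow> (real^'n) set \<Rightarrow> bool" where
  "nonsingular_on H T \<longleftrightarrow>
     (\<exists>vs. is_basis_list vs T \<and> invertible_mat (restricted_matrix H vs))"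

definition nondegenerate ::
  "'i set \<Rightarrow> 'j set \<Rightarrow> nat \<Rightarrow> ('n::finite, 'i, 'j) mpsc \<Rightarrow> real^'n \<Rightarrow> bool" where
  "nondegenerate I J k P x \<longleftrightarrow>
     (\<exists>lam \<mu> \<sigma>1 \<sigma>2.
        W_stationary_with I J k P x lam \<mu> \<sigma>1 \<sigma>2 \<and>
        LICQ I J k P x \<and>
        (\<forall>j\<in>J0 J P x. \<mu> j > 0) \<and>
        (\<forall>m\<in>beta_set k P x. \<sigma>1 m * \<sigma>2 m \<noteq> 0) \<and>
        nonsingular_on (hessian (Lagrangian I J k P lam \<mu> \<sigma>1 \<sigma>2) x)
          (tangent_space I J k P x))"

(* For a twice continuously differentiable problem, finite I and J, and r \<ge> 0, the set below
   is bounded and nonempty, and its supremum is attained. *)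
definition C2_norm ::
  "'i set \<Rightarrow> 'j set \<Rightarrow> nat \<Rightarrow> ('n::finite, 'i, 'j) mpsc \<Rightarrow> real^'n \<Rightarrow> real \<Rightarrow> real" where
  "C2_norm I J k P x0 r =
     Sup (\<Union>\<phi>\<in>components I J k P. \<Union>x\<in>cball x0 r.
            {\<bar>\<phi> x\<bar>} \<union> {\<bar>partial_deriv a \<phi> x\<bar> | a. True} \<union>
            {\<bar>partial_deriv b (partial_deriv a \<phi>) x\<bar> | a b. True})"

definition strongly_stable ::
  "'i set \<Rightarrow> 'j set \<Rightarrow> nat \<Rightarrow> ('n::finite, 'i, 'j) mpsc \<Rightarrow> real^'n \<Rightarrow> bool" where
  "strongly_stable I J k P x0 \<longleftrightarrow>
     W_stationary I J k P x0 \<and>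
     (\<exists>r>0. \<forall>\<epsilon>. 0 < \<epsilon> \<and> \<epsilon> \<le> r \<longrightarrow>
        (\<exists>\<delta>>0. \<forall>Q. C2_mpsc I J k Q \<and> C2_norm I J k (mpsc_diff P Q) x0 r \<le> \<delta> \<longrightarrow>
           (\<exists>x\<in>cball x0 \<epsilon>. W_stationary I J k Q x \<and>
              (\<forall>y\<in>cball x0 r. W_stationary I J k Q y \<longrightarrow> y = x))))"

end

theory Submission
  imports Defs
begin

text \<open>Let \<open>x0\<close> be nondegenerate for the problem \<open>P\<close>, and let \<open>A\<close> be the set of constraints of \<open>P\<close> that
  vanish at \<open>x0\<close> (both factors of a biactive switching pair belong to it). The idea is that near
  \<open>x0\<close> stationarity, for \<open>P\<close> and for all problems \<open>Q\<close> close to \<open>P\<close>, is described by a smooth square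
  system of equations in \<open>x\<close> and the multipliers of \<open>A\<close>: the gradient of the objective is the
  combination of the gradients of \<open>A\<close>, and all constraints in \<open>A\<close> vanish. Nondegeneracy makes the
  inequalities and the combinatorial alternatives disappear. A constraint outside \<open>A\<close> does not
  vanish near \<open>x0\<close>, so its multiplier is zero. A constraint in \<open>A\<close> whose multiplier for \<open>P\<close> is
  nonzero has a nonzero multiplier for \<open>Q\<close>, hence vanishes by complementarity; by ND2 and ND3 this
  covers the active inequalities and the biactive pairs. In a switching pair with only one factor
  in \<open>A\<close>, the other factor is nonzero, and feasibility makes the former vanish
  (\<open>kkt_zero_imp_W_stationary\<close>, \<open>W_multiplier_active\<close>).

  The derivative of the system at \<open>x0\<close> is essentially the bordered Hessian of the Lagrangian,
  which is injective by LICQ and ND4 (\<open>kkt_system_deriv_injective\<close>). The \<open>C\<^sup>2\<close> norm on the data controls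
  values and Lipschitz constants of the system (\<open>norm_kkt_map_le\<close>, \<open>norm_kkt_deriv_le\<close>), because the
  system contains derivatives of the data up to order one. So the system of \<open>Q\<close> is a Lipschitz-small
  perturbation of an invertible linear map, and a contraction argument yields a zero close to the
  one of \<open>P\<close>, while expansion makes zeros unique (\<open>near_linear_zero_exists\<close>,
  \<open>near_linear_expanding\<close>).

  Uniqueness is required among all stationary points of \<open>Q\<close> in a ball of fixed radius, whatever
  their multipliers. It remains to see that these multipliers are automatically close to those of
  \<open>P\<close>, and this follows from the same expansion estimate, as the system is affine in the multipliers
  (\<open>multiplier_near\<close>).\<close>

section \<open>Twice continuously differentiable functions\<close>

lemma has_derivative_grad:
  assumes "\<phi> differentiable (at x)"
  shows "(\<phi> has_derivative (\<lambda>v. grad \<phi> x \<bullet> v)) (at x)"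
proof -
  let ?L = "frechet_derivative \<phi> (at x)"
  have L: "(\<phi> has_derivative ?L) (at x)"
    using assms by (simp add: frechet_derivative_works)
  then have "linear ?L"
    by (rule has_derivative_linear)
  have "?L v = grad \<phi> x \<bullet> v" for v
  proof -
    have "?L v = ?L (\<Sum>i\<in>UNIV. (v $ i) *\<^sub>R axis i 1)"
      using basis_expansion[of v] by (simp add: scalar_mult_eq_scaleR)
    also have "\<dots> = (\<Sum>i\<in>UNIV. v $ i * ?L (axis i 1))"
      by (simp add: linear_sum[OF \<open>linear ?L\<close>] linear_scale[OF \<open>linear ?L\<close>])
    also have "\<dots> = grad \<phi> x \<bullet> v"
      by (simp add: grad_def partial_deriv_def inner_vec_def mult.commute)
    finally show ?thesis .
  qed
  then have "?L = (\<lambda>v. grad \<phi> x \<bullet> v)" by auto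
  with L show ?thesis by simp
qed

lemma C2_has_derivative:
  assumes "C2 \<phi>"
  shows "(\<phi> has_derivative (\<lambda>v. grad \<phi> x \<bullet> v)) (at x)"
  using assms by (intro has_derivative_grad) (simp add: C2_def differentiable_on_def)

text \<open>By the index convention of \<open>hessian\<close>, differentiating the gradient multiplies with the Hessian
  from the right.\<close>

lemma C2_grad_has_derivative:
  fixes \<phi> :: "real^'n::finite \<Rightarrow> real"
  assumes "C2 \<phi>"
  shows "(grad \<phi> has_derivative (\<lambda>v. v v* hessian \<phi> x)) (at x)"
proof (subst has_derivative_componentwise_within, rule ballI)
  fix i :: "real^'n" assume "i \<in> Basis"
  then obtain a where i: "i = axis a 1" by (auto simp: Basis_vec_def)
  have "(partial_deriv a \<phi> has_derivative (\<lambda>v. grad (partial_deriv a \<phi>) x \<bullet> v)) (at x)"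
    using assms by (intro has_derivative_grad) (simp add: C2_def differentiable_on_def)
  moreover have "grad (partial_deriv a \<phi>) x \<bullet> v = (v v* hessian \<phi> x) \<bullet> i" for v
    by (simp add: i inner_axis grad_def hessian_def vector_matrix_mult_def)
       (simp add: inner_vec_def mult.commute)
  moreover have "grad \<phi> y \<bullet> i = partial_deriv a \<phi> y" for y
    by (simp add: i inner_axis grad_def)
  ultimately show "((\<lambda>y. grad \<phi> y \<bullet> i) has_derivative (\<lambda>v. (v v* hessian \<phi> x) \<bullet> i)) (at x)"
    by simp
qed

lemma C2_continuous_hessian: "C2 \<phi> \<Longrightarrow> continuous_on S (hessian \<phi>)"
  unfolding C2_def hessian_def
  by (intro continuous_on_vec_lambda) (meson continuous_on_subset subset_UNIV)

lemma C2_continuous_grad: "C2 \<phi> \<Longrightarrow> continuous_on S (grad \<phi>)"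
  by (meson C2_grad_has_derivative continuous_at_imp_continuous_on has_derivative_continuous)

text \<open>Partial derivatives of partial derivatives are awkward to compute with. In terms of total
  derivatives, the closure properties of \<open>C2\<close> become applications of the derivative rules.\<close>

lemma C2_characterization:
  fixes \<phi> :: "real^'n::finite \<Rightarrow> real"
  assumes g: "\<And>x. (\<phi> has_derivative (\<lambda>v. g x \<bullet> v)) (at x)"
    and H: "\<And>x. (g has_derivative (\<lambda>v. v v* H x)) (at x)"
    and cont: "continuous_on UNIV H"
  shows "C2 \<phi>" "grad \<phi> = g" "hessian \<phi> = H"
proof -
  have p1: "partial_deriv a \<phi> = (\<lambda>x. g x $ a)" for a
    by (simp add: fun_eq_iff partial_deriv_def frechet_derivative_at[OF g, symmetric] inner_axis)
  have d2: "((\<lambda>x. g x $ a) has_derivative (\<lambda>v. (v v* H x) $ a)) (at x)" for a x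
    using bounded_linear.has_derivative[OF bounded_linear_vec_nth H] .
  have ax: "(axis b 1 v* H x) $ a = H x $ b $ a" for a b x
    by (simp add: vector_matrix_mult_def axis_def if_distrib[where f = "\<lambda>t. t * _"] cong: if_cong)
  have p2: "partial_deriv b (partial_deriv a \<phi>) = (\<lambda>x. H x $ b $ a)" for a b
    unfolding p1
    by (simp add: fun_eq_iff partial_deriv_def frechet_derivative_at[OF d2, symmetric] ax)
  show "grad \<phi> = g"
    by (simp add: fun_eq_iff grad_def p1)
  show "hessian \<phi> = H"
    by (simp add: fun_eq_iff hessian_def p2 Finite_Cartesian_Product.vec_eq_iff)
  show "C2 \<phi>"
    unfolding C2_def p2 unfolding p1
  proof (intro conjI allI)
    show "\<phi> differentiable_on UNIV"
      using g by (auto simp: differentiable_on_def differentiable_def)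
    show "(\<lambda>x. g x $ a) differentiable_on UNIV" for a
      using d2 by (auto simp: differentiable_on_def differentiable_def)
    show "continuous_on UNIV (\<lambda>x. H x $ b $ a)" for a b
      by (intro continuous_on_component cont)
  qed
qed

lemma vector_matrix_mult_linear_combination:
  fixes H :: "real^'m::finite^'n::finite"
  shows "v v* (H - (\<Sum>c\<in>A. t c *\<^sub>R K c)) = v v* H - (\<Sum>c\<in>A. t c *\<^sub>R (v v* K c))"
proof (subst Finite_Cartesian_Product.vec_eq_iff, rule allI)
  fix i
  have "(v v* (H - (\<Sum>c\<in>A. t c *\<^sub>R K c))) $ i
      = (\<Sum>j\<in>UNIV. v $ j * H $ j $ i) - (\<Sum>j\<in>UNIV. \<Sum>c\<in>A. t c * (v $ j * K c $ j $ i))"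
    by (simp add: vector_matrix_mult_def right_diff_distrib sum_subtractf sum_distrib_left mult.left_commute)
  also have "(\<Sum>j\<in>UNIV. \<Sum>c\<in>A. t c * (v $ j * K c $ j $ i))
      = (\<Sum>c\<in>A. t c * (\<Sum>j\<in>UNIV. v $ j * K c $ j $ i))"
    by (subst sum.swap) (simp add: sum_distrib_left)
  finally show "(v v* (H - (\<Sum>c\<in>A. t c *\<^sub>R K c))) $ i
      = (v v* H - (\<Sum>c\<in>A. t c *\<^sub>R (v v* K c))) $ i"
    by (simp add: vector_matrix_mult_def)
qed

lemma C2_linear_combination:
  fixes f :: "real^'n::finite \<Rightarrow> real" and t :: "'c \<Rightarrow> real"
  assumes "C2 f" and "\<And>c. c \<in> A \<Longrightarrow> C2 (\<phi> c)"
  defines "F \<equiv> \<lambda>x. f x - (\<Sum>c\<in>A. t c * \<phi> c x)"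
  shows "C2 F"
    and "grad F = (\<lambda>x. grad f x - (\<Sum>c\<in>A. t c *\<^sub>R grad (\<phi> c) x))"
    and "hessian F = (\<lambda>x. hessian f x - (\<Sum>c\<in>A. t c *\<^sub>R hessian (\<phi> c) x))"
proof -
  let ?g = "\<lambda>x. grad f x - (\<Sum>c\<in>A. t c *\<^sub>R grad (\<phi> c) x)"
  let ?H = "\<lambda>x. hessian f x - (\<Sum>c\<in>A. t c *\<^sub>R hessian (\<phi> c) x)"
  have 1: "(F has_derivative (\<lambda>v. ?g x \<bullet> v)) (at x)" for x
    unfolding F_def
    by (auto intro!: derivative_eq_intros C2_has_derivative assms
        simp: inner_diff_left inner_sum_left)
  have 2: "(?g has_derivative (\<lambda>v. v v* ?H x)) (at x)" for x
    unfolding vector_matrix_mult_linear_combination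
    by (auto intro!: derivative_eq_intros C2_grad_has_derivative assms)
  have 3: "continuous_on UNIV ?H"
    by (intro continuous_intros C2_continuous_hessian assms)
  show "C2 F" "grad F = ?g" "hessian F = ?H"
    using C2_characterization[OF 1 2 3] by auto
qed

lemma C2_diff:
  assumes "C2 \<phi>" "C2 \<psi>"
  shows "C2 (\<lambda>x. \<phi> x - \<psi> x)"
    and "grad (\<lambda>x. \<phi> x - \<psi> x) = (\<lambda>x. grad \<phi> x - grad \<psi> x)"
  using C2_linear_combination[of \<phi> "{()}" "\<lambda>_. \<psi>" "\<lambda>_. 1"] assms by auto

definition C2_small_at :: "real \<Rightarrow> (real^'n::finite \<Rightarrow> real) \<Rightarrow> real^'n \<Rightarrow> bool" where
  "C2_small_at \<delta> \<phi> x \<longleftrightarrow> \<bar>\<phi> x\<bar> \<le> \<delta> \<and> (\<forall>a. \<bar>partial_deriv a \<phi> x\<bar> \<le> \<delta>) \<and>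
     (\<forall>a b. \<bar>partial_deriv b (partial_deriv a \<phi>) x\<bar> \<le> \<delta>)"

lemma C2_small_at_grad:
  fixes \<phi> :: "real^'n::finite \<Rightarrow> real" and \<delta> :: real
  assumes "C2_small_at \<delta> \<phi> x"
  shows "norm (grad \<phi> x) \<le> real CARD('n) * \<delta>"
proof -
  have "norm (grad \<phi> x) \<le> (\<Sum>i\<in>UNIV. \<bar>grad \<phi> x $ i\<bar>)"
    by (rule norm_le_l1_cart)
  also have "\<dots> \<le> (\<Sum>i\<in>(UNIV::'n set). \<delta>)"
    using assms by (intro sum_mono) (simp add: C2_small_at_def grad_def)
  finally show ?thesis by simp
qed

lemma C2_small_at_hessian:
  fixes \<phi> :: "real^'n::finite \<Rightarrow> real" and \<delta> :: real
  assumes "C2_small_at \<delta> \<phi> x"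
  shows "norm (v v* hessian \<phi> x) \<le> real CARD('n) * real CARD('n) * \<delta> * norm v"
proof -
  have "norm (v v* hessian \<phi> x) \<le> (\<Sum>i\<in>UNIV. \<bar>(v v* hessian \<phi> x) $ i\<bar>)"
    by (rule norm_le_l1_cart)
  also have "\<dots> \<le> (\<Sum>i\<in>(UNIV::'n set). \<Sum>j\<in>(UNIV::'n set). \<delta> * norm v)"
  proof (intro sum_mono)
    fix i
    have "\<bar>(v v* hessian \<phi> x) $ i\<bar> \<le> (\<Sum>j\<in>UNIV. \<bar>hessian \<phi> x $ j $ i * v $ j\<bar>)"
      unfolding vector_matrix_mult_def by (simp add: sum_abs mult.commute)
    also have "\<dots> \<le> (\<Sum>j\<in>(UNIV::'n set). \<delta> * norm v)"
      using assms
      by (intro sum_mono) (auto simp: abs_mult C2_small_at_def hessian_def component_le_norm_cart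
          intro!: mult_mono' )
    finally show "\<bar>(v v* hessian \<phi> x) $ i\<bar> \<le> (\<Sum>j\<in>(UNIV::'n set). \<delta> * norm v)" .
  qed
  finally show ?thesis by (simp add: algebra_simps)
qed

text \<open>The set under the supremum in the norm is bounded, because the components are finitely
  many and their derivatives are continuous on a compact ball; without boundedness the supremum
  would say nothing about its elements.\<close>

lemma C2_norm_le_imp_C2_small_at:
  fixes P :: "('n::finite, 'i, 'j) mpsc"
  assumes "finite I" "finite J" and "C2_mpsc I J k P"
    and "C2_norm I J k P x0 r \<le> \<delta>"
    and "\<phi> \<in> components I J k P" and "x \<in> cball x0 r"
  shows "C2_small_at \<delta> \<phi> x"
proof -
  let ?V = "\<lambda>\<psi> x. {\<bar>\<psi> x\<bar>} \<union> {\<bar>partial_deriv a \<psi> x\<bar> | a. True} \<union>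
            {\<bar>partial_deriv b (partial_deriv a \<psi>) x\<bar> | a b. True}"
  let ?S = "\<Union>\<psi>\<in>components I J k P. \<Union>x\<in>cball x0 r. ?V \<psi> x"
  have fin: "finite (components I J k P)"
    using assms(1,2) by (simp add: components_def)
  have "bdd_above (\<Union>x\<in>cball x0 r. ?V \<psi> x)" if "\<psi> \<in> components I J k P" for \<psi>
  proof -
    have C2: "C2 \<psi>" using assms(3) that by (simp add: C2_mpsc_def)
    have 1: "continuous_on (cball x0 r) \<psi>" "\<And>a. continuous_on (cball x0 r) (partial_deriv a \<psi>)"
      using C2 unfolding C2_def
      by (meson continuous_on_subset differentiable_imp_continuous_on subset_UNIV)+
    have 2: "\<And>a b. continuous_on (cball x0 r) (partial_deriv b (partial_deriv a \<psi>))"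
      using C2 unfolding C2_def by (meson continuous_on_subset subset_UNIV)
    have bd: "\<exists>B. \<forall>x\<in>cball x0 r. \<bar>h x\<bar> \<le> B" if "continuous_on (cball x0 r) h"
      for h :: "real^'n \<Rightarrow> real"
      using compact_imp_bounded[OF compact_continuous_image[OF that compact_cball]]
      by (auto simp: bounded_iff)
    obtain B0 where B0: "\<forall>x\<in>cball x0 r. \<bar>\<psi> x\<bar> \<le> B0" using bd 1 by blast
    obtain B1 where B1: "\<forall>a. \<forall>x\<in>cball x0 r. \<bar>partial_deriv a \<psi> x\<bar> \<le> B1 a" using bd[OF 1(2)] by metis
    obtain B2 where B2: "\<forall>a b. \<forall>x\<in>cball x0 r. \<bar>partial_deriv b (partial_deriv a \<psi>) x\<bar> \<le> B2 (a, b)"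
    proof -
      have "\<forall>t. \<exists>B. \<forall>x\<in>cball x0 r. \<bar>partial_deriv (snd t) (partial_deriv (fst t) \<psi>) x\<bar> \<le> B"
        using bd[OF 2] by blast
      from choice[OF this] that show thesis by fastforce
    qed
    let ?B = "Max ({B0} \<union> range B1 \<union> range B2)"
    show ?thesis
    proof (rule bdd_aboveI[of _ ?B])
      fix y assume "y \<in> (\<Union>x\<in>cball x0 r. ?V \<psi> x)"
      then have "\<exists>t\<in>{B0} \<union> range B1 \<union> range B2. y \<le> t"
        using B0 B1 B2 by fastforce
      then show "y \<le> ?B"
        by (subst Max_ge_iff) auto
    qed
  qed
  then have bdd: "bdd_above ?S"
    unfolding bdd_above_UN[OF fin] by (rule ballI)
  have "y \<le> \<delta>" if "y \<in> ?V \<phi> x" for y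
  proof -
    have "y \<in> ?S" using that assms(5,6) by blast
    from cSup_upper[OF this bdd] show ?thesis
      using assms(4) unfolding C2_norm_def by linarith
  qed
  then show ?thesis
    unfolding C2_small_at_def by auto
qed

section \<open>Zeros of perturbed maps\<close>

lemma lipschitz_from_derivative_on_Basis:
  fixes F :: "'a::euclidean_space \<Rightarrow> 'b::real_normed_vector" and B :: real
  assumes "convex S"
    and der: "\<And>z. z \<in> S \<Longrightarrow> (F has_derivative D z) (at z)"
    and bound: "\<And>z b. z \<in> S \<Longrightarrow> b \<in> Basis \<Longrightarrow> norm (D z b) \<le> B"
    and "x \<in> S" "y \<in> S"
  shows "norm (F x - F y) \<le> DIM('a) * B * norm (x - y)"
proof (rule differentiable_bound[OF assms(1) _ _ assms(4,5)])
  show "(F has_derivative D z) (at z within S)" if "z \<in> S" for z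
    using der[OF that] by (rule has_derivative_at_withinI)
  fix z assume z: "z \<in> S"
  have lin: "linear (D z)" using der[OF z] by (rule has_derivative_linear)
  show "onorm (D z) \<le> DIM('a) * B"
  proof (rule onorm_le)
    fix v
    have "D z v = D z (\<Sum>b\<in>Basis. (v \<bullet> b) *\<^sub>R b)"
      by (simp add: euclidean_representation)
    also have "\<dots> = (\<Sum>b\<in>Basis. (v \<bullet> b) *\<^sub>R D z b)"
      by (simp add: linear_sum[OF lin] linear_scale[OF lin])
    finally have "norm (D z v) \<le> (\<Sum>b\<in>Basis. norm ((v \<bullet> b) *\<^sub>R D z b))"
      by (metis norm_sum)
    also have "\<dots> \<le> (\<Sum>b\<in>(Basis::'a set). norm v * B)"
      using bound[OF z] by (intro sum_mono) (auto intro!: mult_mono' Basis_le_norm)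
    finally show "norm (D z v) \<le> DIM('a) * B * norm v" by (simp add: algebra_simps)
  qed
qed

text \<open>The derivative of \<open>F - D z0\<close> is small near \<open>z0\<close>, and the mean value inequality turns this into
  strict differentiability.\<close>

lemma strictly_differentiable:
  fixes F :: "'a::euclidean_space \<Rightarrow> 'b::real_normed_vector"
  assumes der: "\<And>z. (F has_derivative D z) (at z)"
    and cont: "\<And>b. b \<in> Basis \<Longrightarrow> isCont (\<lambda>z. D z b) z0"
    and "\<eta> > 0"
  obtains \<rho> where "\<rho> > 0"
    and "\<And>z z'. z \<in> cball z0 \<rho> \<Longrightarrow> z' \<in> cball z0 \<rho> \<Longrightarrow>
      norm (F z - F z' - D z0 (z - z')) \<le> \<eta> * norm (z - z')"
proof -
  have lin: "linear (D z0)" using der by (rule has_derivative_linear)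
  define e where "e = \<eta> / DIM('a)"
  have "e > 0" using \<open>\<eta> > 0\<close> by (simp add: e_def)
  have "\<forall>\<^sub>F z in at z0. \<forall>b\<in>Basis. dist (D z b) (D z0 b) < e"
    using cont \<open>e > 0\<close> by (intro eventually_ball_finite) (auto simp: isCont_def tendsto_iff)
  then obtain d where "d > 0"
    and d: "\<And>z b. z \<noteq> z0 \<Longrightarrow> dist z z0 < d \<Longrightarrow> b \<in> Basis \<Longrightarrow> dist (D z b) (D z0 b) < e"
    by (auto simp: eventually_at)
  have *: "norm (D z b - D z0 b) \<le> e" if "z \<in> cball z0 (d/2)" "b \<in> Basis" for z b
    using d[of z b] that \<open>d > 0\<close> \<open>e > 0\<close> by (cases "z = z0") (auto simp: dist_norm norm_minus_commute)
  have derF: "((\<lambda>z. F z - D z0 z) has_derivative (\<lambda>v. D z v - D z0 v)) (at z)" for z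
    using der by (intro has_derivative_diff linear_imp_has_derivative lin)
  show ?thesis
  proof (rule that[of "d/2"])
    show "d/2 > 0" using \<open>d > 0\<close> by simp
    fix z z' assume "z \<in> cball z0 (d/2)" "z' \<in> cball z0 (d/2)"
    from lipschitz_from_derivative_on_Basis[OF convex_cball derF * this]
    have "norm (F z - D z0 z - (F z' - D z0 z')) \<le> DIM('a) * e * norm (z - z')" .
    then show "norm (F z - F z' - D z0 (z - z')) \<le> \<eta> * norm (z - z')"
      by (simp add: e_def linear_diff[OF lin] algebra_simps)
  qed
qed

text \<open>Expansion gives the uniqueness of zeros; it also bounds distances to points that are not known
  to be zeros, and in this form it serves to locate multipliers.\<close>

lemma near_linear_expanding:
  fixes G :: "'a::real_normed_vector \<Rightarrow> 'b::real_normed_vector"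
  assumes "m * norm (z - z') \<le> norm (T (z - z'))"
    and "norm (G z - G z' - T (z - z')) \<le> m / 2 * norm (z - z')"
  shows "m / 2 * norm (z - z') \<le> norm (G z - G z')"
proof -
  have "norm (T (z - z')) \<le> norm (G z - G z') + norm (G z - G z' - T (z - z'))"
    by (metis norm_triangle_sub norm_minus_commute)
  with assms show ?thesis by (simp add: field_simps)
qed

text \<open>The quantitative core of the inverse function theorem. The simplified Newton map
  \<open>z \<mapsto> z - T\<^sup>-\<^sup>1 (G z)\<close> is a contraction with factor \<open>1/2\<close>, and the bound on \<open>G z0\<close>
  makes it map the ball into itself.\<close>

lemma near_linear_zero_exists:
  fixes G :: "'a::euclidean_space \<Rightarrow> 'a"
  assumes T: "linear T" "\<And>v. m * norm v \<le> norm (T v)" and "m > 0"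
    and lip: "\<And>z z'. z \<in> cball z0 \<epsilon> \<Longrightarrow> z' \<in> cball z0 \<epsilon> \<Longrightarrow>
      norm (G z - G z' - T (z - z')) \<le> m / 2 * norm (z - z')"
    and "\<epsilon> \<ge> 0" and G0: "norm (G z0) \<le> m / 2 * \<epsilon>"
  shows "\<exists>z\<in>cball z0 \<epsilon>. G z = 0"
proof -
  have "inj T"
    unfolding linear_injective_0[OF T(1)]
    using T(2) \<open>m > 0\<close> by (metis mult_pos_pos norm_zero not_le zero_less_norm_iff)
  then obtain T' where T': "linear T'" "\<And>v. T (T' v) = v" "\<And>v. T' (T v) = v"
    using linear_injective_isomorphism[OF T(1)] by auto
  have T'_bound: "norm (T' v) \<le> norm v / m" for v
    using T(2)[of "T' v"] \<open>m > 0\<close> by (simp add: T'(2) field_simps)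
  let ?N = "\<lambda>z. z - T' (G z)"
  have contr: "dist (?N z) (?N z') \<le> 1/2 * dist z z'" if "z \<in> cball z0 \<epsilon>" "z' \<in> cball z0 \<epsilon>" for z z'
  proof -
    have "?N z - ?N z' = T' (- (G z - G z' - T (z - z')))"
      by (simp add: linear_diff[OF T'(1)] linear_neg[OF T'(1)] linear_add[OF T'(1)] T'(3)
          linear_diff[OF T(1)] algebra_simps)
    then have "norm (?N z - ?N z') \<le> norm (G z - G z' - T (z - z')) / m"
      using T'_bound[of "- (G z - G z' - T (z - z'))"] by (simp add: norm_minus_commute)
    also have "\<dots> \<le> 1/2 * norm (z - z')"
      using lip[OF that] \<open>m > 0\<close> by (simp add: field_simps)
    finally show ?thesis by (simp add: dist_norm)
  qed
  have "\<exists>!z\<in>cball z0 \<epsilon>. ?N z = z"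
  proof (rule Banach_fix[where c = "1/2"])
    show "?N ` cball z0 \<epsilon> \<subseteq> cball z0 \<epsilon>"
    proof safe
      fix z assume z: "z \<in> cball z0 \<epsilon>"
      have "dist z0 (?N z) \<le> dist (?N z0) z0 + dist (?N z) (?N z0)"
        by (metis dist_commute dist_triangle)
      also have "dist (?N z0) z0 \<le> \<epsilon> / 2"
      proof -
      have "norm (G z0) / m \<le> \<epsilon> / 2"
        using G0 \<open>m > 0\<close> by (simp add: field_simps)
      from order_trans[OF T'_bound this] show ?thesis by (simp add: dist_norm)
    qed
      also have "dist (?N z) (?N z0) \<le> \<epsilon> / 2"
        using contr[OF z, of z0] z \<open>\<epsilon> \<ge> 0\<close> by (auto simp: dist_commute)
      finally show "?N z \<in> cball z0 \<epsilon>" by simp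
    qed
  qed (use \<open>\<epsilon> \<ge> 0\<close> contr in \<open>auto simp: compact_imp_complete\<close>)
  then obtain z where z: "z \<in> cball z0 \<epsilon>" "T' (G z) = 0" by auto
  then have "G z = 0"
    using T'(2)[of "G z"] linear_0[OF T(1)] by simp
  with z(1) show ?thesis by blast
qed

section \<open>The system of stationarity and activity equations\<close>

text \<open>The unknowns are pairs \<open>(x, w)\<close>. The multiplier of a constraint \<open>c\<close> is the coordinate \<open>w \<bullet> a c\<close>,
  where \<open>a\<close> assigns different basis vectors to different constraints in \<open>A\<close>. Thus the space of
  unknowns is a fixed Euclidean space, although \<open>A\<close> depends on the point at hand. The map is
  linear in the data \<open>f\<close> and \<open>\<phi>\<close>, so that differences of systems are again of this form.\<close>

definition kkt_map ::
  "'c set \<Rightarrow> ('c \<Rightarrow> real^'n::finite) \<Rightarrow> (real^'n \<Rightarrow> real) \<Rightarrow> ('c \<Rightarrow> real^'n \<Rightarrow> real) \<Rightarrow>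
   (real^'n) \<times> (real^'n) \<Rightarrow> (real^'n) \<times> (real^'n)" where
  "kkt_map A a f \<phi> z =
    (grad f (fst z) - (\<Sum>c\<in>A. (snd z \<bullet> a c) *\<^sub>R grad (\<phi> c) (fst z)),
     \<Sum>c\<in>A. \<phi> c (fst z) *\<^sub>R a c)"

definition kkt_deriv ::
  "'c set \<Rightarrow> ('c \<Rightarrow> real^'n::finite) \<Rightarrow> (real^'n \<Rightarrow> real) \<Rightarrow> ('c \<Rightarrow> real^'n \<Rightarrow> real) \<Rightarrow>
   (real^'n) \<times> (real^'n) \<Rightarrow> (real^'n) \<times> (real^'n) \<Rightarrow> (real^'n) \<times> (real^'n)" where
  "kkt_deriv A a f \<phi> z h =
    (fst h v* hessian f (fst z) -
       (\<Sum>c\<in>A. (snd z \<bullet> a c) *\<^sub>R (fst h v* hessian (\<phi> c) (fst z)) +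
               (snd h \<bullet> a c) *\<^sub>R grad (\<phi> c) (fst z)),
     \<Sum>c\<in>A. (grad (\<phi> c) (fst z) \<bullet> fst h) *\<^sub>R a c)"

definition unused_coordinates :: "'c set \<Rightarrow> ('c \<Rightarrow> 'a::real_inner) \<Rightarrow> 'a \<Rightarrow> 'a" where
  "unused_coordinates A a w = w - (\<Sum>c\<in>A. (w \<bullet> a c) *\<^sub>R a c)"

text \<open>Requiring that the coordinates of \<open>w\<close> that belong to no constraint vanish makes the number of
  equations equal to the number of unknowns.\<close>

definition kkt_system ::
  "'c set \<Rightarrow> ('c \<Rightarrow> real^'n::finite) \<Rightarrow> (real^'n \<Rightarrow> real) \<Rightarrow> ('c \<Rightarrow> real^'n \<Rightarrow> real) \<Rightarrow>
   (real^'n) \<times> (real^'n) \<Rightarrow> (real^'n) \<times> (real^'n)" where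
  "kkt_system A a f \<phi> z = kkt_map A a f \<phi> z + (0, unused_coordinates A a (snd z))"

definition kkt_system_deriv ::
  "'c set \<Rightarrow> ('c \<Rightarrow> real^'n::finite) \<Rightarrow> (real^'n \<Rightarrow> real) \<Rightarrow> ('c \<Rightarrow> real^'n \<Rightarrow> real) \<Rightarrow>
   (real^'n) \<times> (real^'n) \<Rightarrow> (real^'n) \<times> (real^'n) \<Rightarrow> (real^'n) \<times> (real^'n)" where
  "kkt_system_deriv A a f \<phi> z h = kkt_deriv A a f \<phi> z h + (0, unused_coordinates A a (snd h))"

lemma inner_sum_Basis_family:
  assumes "finite A" "inj_on a A" "a ` A \<subseteq> Basis" "c \<in> A"
  shows "(\<Sum>d\<in>A. t d *\<^sub>R a d) \<bullet> a c = t c"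
proof -
  have "(\<Sum>d\<in>A. t d *\<^sub>R a d) \<bullet> a c = (\<Sum>d\<in>A. if d = c then t d else 0)"
    unfolding inner_sum_left using assms
    by (intro sum.cong refl) (auto simp: inner_Basis inj_on_eq_iff image_subset_iff)
  then show ?thesis using assms by simp
qed

lemma unused_coordinates_inner:
  assumes "finite A" "inj_on a A" "a ` A \<subseteq> Basis" "c \<in> A"
  shows "unused_coordinates A a w \<bullet> a c = 0"
  using inner_sum_Basis_family[OF assms, of "\<lambda>c. w \<bullet> a c"]
  by (simp add: unused_coordinates_def inner_diff_left)

lemma linear_unused_coordinates: "linear (unused_coordinates A a)"
  by (rule linearI) (simp_all add: unused_coordinates_def inner_add_left scaleR_left_distrib
      sum.distrib scaleR_sum_right scaleR_right_diff_distrib)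

lemma has_derivative_compose_fst:
  assumes "(g has_derivative g') (at (fst z))"
  shows "((\<lambda>z. g (fst z)) has_derivative (\<lambda>h. g' (fst h))) (at z)"
  using has_derivative_compose[OF has_derivative_fst[OF has_derivative_ident] assms] by simp

lemma kkt_map_has_derivative:
  assumes "C2 f" "\<And>c. c \<in> A \<Longrightarrow> C2 (\<phi> c)"
  shows "(kkt_map A a f \<phi> has_derivative kkt_deriv A a f \<phi> z) (at z)"
proof -
  note 1 = has_derivative_compose_fst[OF C2_has_derivative] has_derivative_compose_fst[OF C2_grad_has_derivative]
  show ?thesis
    unfolding kkt_map_def[abs_def] kkt_deriv_def[abs_def]
    by (auto intro!: derivative_eq_intros 1 assms simp: algebra_simps)
qed

lemma kkt_system_has_derivative:
  assumes "C2 f" "\<And>c. c \<in> A \<Longrightarrow> C2 (\<phi> c)"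
  shows "(kkt_system A a f \<phi> has_derivative kkt_system_deriv A a f \<phi> z) (at z)"
proof -
  have "((\<lambda>z. (0, unused_coordinates A a (snd z))) has_derivative
      (\<lambda>h. (0::real^'n, unused_coordinates A a (snd h)))) (at z)"
    by (intro linear_imp_has_derivative linearI)
       (simp_all add: linear_add[OF linear_unused_coordinates]
          linear_scale[OF linear_unused_coordinates])
  from has_derivative_add[OF kkt_map_has_derivative[OF assms] this] show ?thesis
    by (simp add: kkt_system_def[abs_def] kkt_system_deriv_def[abs_def])
qed

lemma continuous_on_vector_matrix_mult:
  fixes M :: "'a::topological_space \<Rightarrow> real^'m::finite^'n::finite"
  assumes "continuous_on S M"
  shows "continuous_on S (\<lambda>x. v v* M x)"
  unfolding vector_matrix_mult_def
  by (intro continuous_on_vec_lambda continuous_intros continuous_on_component assms)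

lemma kkt_system_deriv_continuous:
  assumes "C2 f" "\<And>c. c \<in> A \<Longrightarrow> C2 (\<phi> c)"
  shows "isCont (\<lambda>z. kkt_system_deriv A a f \<phi> z h) z"
proof -
  note [continuous_intros] = continuous_on_vector_matrix_mult
    continuous_on_compose2[OF C2_continuous_hessian[where S = UNIV] _ subset_UNIV]
    continuous_on_compose2[OF C2_continuous_grad[where S = UNIV] _ subset_UNIV]
  have "continuous_on UNIV (\<lambda>z. kkt_system_deriv A a f \<phi> z h)"
    unfolding kkt_system_deriv_def kkt_deriv_def
    by (intro continuous_intros assms)
  then show ?thesis by (metis UNIV_I continuous_on_eq_continuous_at open_UNIV)
qed

text \<open>The part that does not involve the data cancels, hence \<open>kkt_map\<close> on the left.\<close>

lemma kkt_map_diff: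
  assumes "C2 f" "C2 f'" "\<And>c. c \<in> A \<Longrightarrow> C2 (\<phi> c)" "\<And>c. c \<in> A \<Longrightarrow> C2 (\<phi>' c)"
  shows "kkt_map A a (\<lambda>x. f x - f' x) (\<lambda>c x. \<phi> c x - \<phi>' c x) z
    = kkt_system A a f \<phi> z - kkt_system A a f' \<phi>' z"
proof -
  have "(\<Sum>c\<in>A. (snd z \<bullet> a c) *\<^sub>R grad (\<lambda>x. \<phi> c x - \<phi>' c x) (fst z))
      = (\<Sum>c\<in>A. (snd z \<bullet> a c) *\<^sub>R grad (\<phi> c) (fst z)) - (\<Sum>c\<in>A. (snd z \<bullet> a c) *\<^sub>R grad (\<phi>' c) (fst z))"
    by (simp add: C2_diff assms scaleR_right_diff_distrib sum_subtractf)
  then show ?thesis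
    by (simp add: kkt_system_def kkt_map_def C2_diff assms algebra_simps sum_subtractf)
qed

text \<open>A common factor for the next two estimates: for data of \<open>C\<^sup>2\<close> size \<open>\<delta>\<close> and multipliers bounded by \<open>W\<close>,
  gradients and Hessians contribute at most \<open>n\<^sup>2 \<delta>\<close> each, where \<open>n\<close> is the dimension.\<close>

definition kkt_constant :: "'n::finite itself \<Rightarrow> 'c set \<Rightarrow> real \<Rightarrow> real" where
  "kkt_constant _ A W = real CARD('n) * real CARD('n) * (1 + real (card A) * (W + 2))"

lemma kkt_constant_pos: "0 \<le> W \<Longrightarrow> 0 < kkt_constant TYPE('n::finite) A W"
  unfolding kkt_constant_def
  by (intro mult_pos_pos add_pos_nonneg) auto

lemma norm_kkt_deriv_le:
  fixes a :: "'c \<Rightarrow> real^'n::finite" and \<delta> W :: real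
  assumes "\<And>c. c \<in> A \<Longrightarrow> norm (a c) \<le> 1"
    and f: "C2_small_at \<delta> f (fst z)" and \<phi>: "\<And>c. c \<in> A \<Longrightarrow> C2_small_at \<delta> (\<phi> c) (fst z)"
    and W: "norm (snd z) \<le> W" and h: "norm h \<le> 1"
  shows "norm (kkt_deriv A a f \<phi> z h) \<le> kkt_constant TYPE('n) A W * \<delta>"
proof -
  let ?n = "real CARD('n)"
  have h1: "norm (fst h) \<le> 1" "norm (snd h) \<le> 1"
    using h norm_fst_le[of "fst h" "snd h"] norm_snd_le[of "snd h" "fst h"] by auto
  have \<delta>: "0 \<le> \<delta>" using f by (auto simp: C2_small_at_def)
  have n: "1 \<le> ?n" by (simp add: Suc_leI)
  then have nn: "?n \<le> ?n * ?n" by simp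
  have W0: "0 \<le> W" using W norm_ge_zero order_trans by blast
  have n\<delta>: "?n * \<delta> \<le> ?n * ?n * \<delta>" using nn \<delta> by (intro mult_right_mono)
  have hess: "norm (fst h v* hessian \<psi> (fst z)) \<le> ?n * ?n * \<delta>" if "C2_small_at \<delta> \<psi> (fst z)" for \<psi>
    by (rule order_trans[OF C2_small_at_hessian[OF that] mult_left_le[OF h1(1)]]) (simp add: \<delta>)
  have ua: "\<bar>u \<bullet> a c\<bar> \<le> B" if "norm u \<le> B" "c \<in> A" for u B c
    by (rule order_trans[OF Cauchy_Schwarz_ineq2
          order_trans[OF mult_left_le[OF assms(1)[OF that(2)] norm_ge_zero] that(1)]])
  have gr: "norm (grad (\<phi> c) (fst z)) \<le> ?n * ?n * \<delta>" if "c \<in> A" for c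
    by (rule order_trans[OF C2_small_at_grad[OF \<phi>[OF that]] n\<delta>])
  have sum1: "norm (\<Sum>c\<in>A. (snd z \<bullet> a c) *\<^sub>R (fst h v* hessian (\<phi> c) (fst z)) +
               (snd h \<bullet> a c) *\<^sub>R grad (\<phi> c) (fst z)) \<le> real (card A) * ((W + 1) * (?n * ?n * \<delta>))"
  proof (rule sum_norm_bound)
    fix c assume c: "c \<in> A"
    have "norm ((snd z \<bullet> a c) *\<^sub>R (fst h v* hessian (\<phi> c) (fst z))) \<le> W * (?n * ?n * \<delta>)"
      unfolding norm_scaleR using ua[OF W c] hess[OF \<phi>[OF c]] by (intro mult_mono') auto
    moreover have "norm ((snd h \<bullet> a c) *\<^sub>R grad (\<phi> c) (fst z)) \<le> 1 * (?n * ?n * \<delta>)"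
      unfolding norm_scaleR using ua[OF h1(2) c] gr[OF c] by (intro mult_mono') auto
    ultimately show "norm ((snd z \<bullet> a c) *\<^sub>R (fst h v* hessian (\<phi> c) (fst z)) +
               (snd h \<bullet> a c) *\<^sub>R grad (\<phi> c) (fst z)) \<le> (W + 1) * (?n * ?n * \<delta>)"
      by (intro norm_triangle_le) (simp add: algebra_simps)
  qed
  have sum2: "norm (\<Sum>c\<in>A. (grad (\<phi> c) (fst z) \<bullet> fst h) *\<^sub>R a c) \<le> real (card A) * (?n * ?n * \<delta>)"
  proof (rule sum_norm_bound)
    fix c assume c: "c \<in> A"
    have "\<bar>grad (\<phi> c) (fst z) \<bullet> fst h\<bar> \<le> ?n * ?n * \<delta>"
      by (rule order_trans[OF Cauchy_Schwarz_ineq2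
            order_trans[OF mult_left_le[OF h1(1) norm_ge_zero] gr[OF c]]])
    then show "norm ((grad (\<phi> c) (fst z) \<bullet> fst h) *\<^sub>R a c) \<le> ?n * ?n * \<delta>"
      unfolding norm_scaleR
      by (rule order_trans[OF mult_left_le[OF assms(1)[OF c] abs_ge_zero]])
  qed
  have "norm (kkt_deriv A a f \<phi> z h) \<le> norm (fst (kkt_deriv A a f \<phi> z h)) + norm (snd (kkt_deriv A a f \<phi> z h))"
    by (metis norm_Pair_le prod.collapse)
  also have "\<dots> \<le> ?n * ?n * \<delta> + real (card A) * ((W + 1) * (?n * ?n * \<delta>)) + real (card A) * (?n * ?n * \<delta>)"
    unfolding kkt_deriv_def fst_conv snd_conv
    by (intro add_mono sum2 order_trans[OF norm_triangle_ineq4] hess f sum1)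
  also have "\<dots> = kkt_constant TYPE('n) A W * \<delta>"
    by (simp add: kkt_constant_def algebra_simps)
  finally show ?thesis .
qed

lemma norm_kkt_map_le:
  fixes a :: "'c \<Rightarrow> real^'n::finite" and \<delta> W :: real
  assumes "\<And>c. c \<in> A \<Longrightarrow> norm (a c) \<le> 1"
    and f: "C2_small_at \<delta> f (fst z)" and \<phi>: "\<And>c. c \<in> A \<Longrightarrow> C2_small_at \<delta> (\<phi> c) (fst z)"
    and W: "norm (snd z) \<le> W"
  shows "norm (kkt_map A a f \<phi> z) \<le> kkt_constant TYPE('n) A W * \<delta>"
proof -
  let ?n = "real CARD('n)"
  have \<delta>: "0 \<le> \<delta>" using f by (auto simp: C2_small_at_def)
  have n: "1 \<le> ?n" by (simp add: Suc_leI)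
  then have nn: "?n \<le> ?n * ?n" by simp
  have n\<delta>: "?n * \<delta> \<le> ?n * ?n * \<delta>" using nn \<delta> by (intro mult_right_mono)
  have "1 * \<delta> \<le> ?n * \<delta>" using n \<delta> by (intro mult_right_mono)
  with n\<delta> have \<delta>n: "\<delta> \<le> ?n * ?n * \<delta>" by linarith
  have gr: "norm (grad \<psi> (fst z)) \<le> ?n * ?n * \<delta>" if "C2_small_at \<delta> \<psi> (fst z)" for \<psi>
    by (rule order_trans[OF C2_small_at_grad[OF that] n\<delta>])
  have sum1: "norm (\<Sum>c\<in>A. (snd z \<bullet> a c) *\<^sub>R grad (\<phi> c) (fst z)) \<le> real (card A) * (W * (?n * ?n * \<delta>))"
  proof (rule sum_norm_bound)
    fix c assume c: "c \<in> A"
    have "\<bar>snd z \<bullet> a c\<bar> \<le> W"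
      by (rule order_trans[OF Cauchy_Schwarz_ineq2
            order_trans[OF mult_left_le[OF assms(1)[OF c] norm_ge_zero] W]])
    then show "norm ((snd z \<bullet> a c) *\<^sub>R grad (\<phi> c) (fst z)) \<le> W * (?n * ?n * \<delta>)"
      unfolding norm_scaleR using gr[OF \<phi>[OF c]] by (intro mult_mono') auto
  qed
  have sum2: "norm (\<Sum>c\<in>A. \<phi> c (fst z) *\<^sub>R a c) \<le> real (card A) * (?n * ?n * \<delta>)"
  proof (rule sum_norm_bound)
    fix c assume c: "c \<in> A"
    have "\<bar>\<phi> c (fst z)\<bar> \<le> ?n * ?n * \<delta>"
      using \<phi>[OF c] \<delta>n by (auto simp: C2_small_at_def)
    then show "norm (\<phi> c (fst z) *\<^sub>R a c) \<le> ?n * ?n * \<delta>"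
      unfolding norm_scaleR
      by (rule order_trans[OF mult_left_le[OF assms(1)[OF c] abs_ge_zero]])
  qed
  have "norm (kkt_map A a f \<phi> z) \<le> norm (fst (kkt_map A a f \<phi> z)) + norm (snd (kkt_map A a f \<phi> z))"
    by (metis norm_Pair_le prod.collapse)
  also have "\<dots> \<le> ?n * ?n * \<delta> + real (card A) * (W * (?n * ?n * \<delta>)) + real (card A) * (?n * ?n * \<delta>)"
    unfolding kkt_map_def fst_conv snd_conv
    by (intro add_mono sum2 order_trans[OF norm_triangle_ineq4] gr f sum1)
  also have "\<dots> = ?n * ?n * (1 + real (card A) * (W + 1)) * \<delta>"
    by (simp add: algebra_simps)
  also have "\<dots> \<le> kkt_constant TYPE('n) A W * \<delta>"
    unfolding kkt_constant_def using \<delta> by (intro mult_right_mono mult_left_mono add_left_mono) auto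
  finally show ?thesis .
qed

lemma kkt_system_eq_0_iff:
  assumes "finite A" "inj_on a A" "a ` A \<subseteq> Basis"
  shows "kkt_system A a f \<phi> (x, w) = 0 \<longleftrightarrow>
    grad f x = (\<Sum>c\<in>A. (w \<bullet> a c) *\<^sub>R grad (\<phi> c) x) \<and> (\<forall>c\<in>A. \<phi> c x = 0) \<and>
    unused_coordinates A a w = 0"
proof -
  have "\<phi> c x = 0" if "(\<Sum>c\<in>A. \<phi> c x *\<^sub>R a c) + unused_coordinates A a w = 0" "c \<in> A" for c
  proof -
    have "0 = ((\<Sum>c\<in>A. \<phi> c x *\<^sub>R a c) + unused_coordinates A a w) \<bullet> a c"
      using that by simp
    also have "\<dots> = \<phi> c x"
      unfolding inner_add_left
      using inner_sum_Basis_family[OF assms that(2), of "\<lambda>c. \<phi> c x"]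
        unused_coordinates_inner[OF assms that(2)] by simp
    finally show ?thesis by simp
  qed
  then show ?thesis
    by (auto simp: kkt_system_def kkt_map_def zero_prod_def)
qed

text \<open>The familiar argument for bordered Hessians: the activity part puts \<open>v\<close> into the tangent space;
  testing the stationarity part with tangent vectors removes the gradients of the constraints, and
  nonsingularity gives \<open>v = 0\<close>; what remains is a linear relation between independent gradients.\<close>

lemma kkt_system_deriv_injective:
  assumes a: "finite A" "inj_on a A" "a ` A \<subseteq> Basis"
    and indep: "\<And>t. (\<Sum>c\<in>A. t c *\<^sub>R grad (\<phi> c) x) = 0 \<Longrightarrow> \<forall>c\<in>A. t c = 0"
    and nonsing: "\<And>v. \<forall>c\<in>A. grad (\<phi> c) x \<bullet> v = 0 \<Longrightarrow>
      (\<And>y. \<forall>c\<in>A. grad (\<phi> c) x \<bullet> y = 0 \<Longrightarrow>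
        v \<bullet> ((hessian f x - (\<Sum>c\<in>A. (w \<bullet> a c) *\<^sub>R hessian (\<phi> c) x)) *v y) = 0) \<Longrightarrow> v = 0"
    and zero: "kkt_system_deriv A a f \<phi> (x, w) (v, u) = 0"
  shows "v = 0 \<and> u = 0"
proof -
  have stat: "v v* hessian f x - (\<Sum>c\<in>A. (w \<bullet> a c) *\<^sub>R (v v* hessian (\<phi> c) x) +
               (u \<bullet> a c) *\<^sub>R grad (\<phi> c) x) = 0"
    and act: "(\<Sum>c\<in>A. (grad (\<phi> c) x \<bullet> v) *\<^sub>R a c) + unused_coordinates A a u = 0"
    using zero by (auto simp: kkt_system_deriv_def kkt_deriv_def zero_prod_def)
  let ?H = "hessian f x - (\<Sum>c\<in>A. (w \<bullet> a c) *\<^sub>R hessian (\<phi> c) x)"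
  have tang: "\<forall>c\<in>A. grad (\<phi> c) x \<bullet> v = 0"
  proof
    fix c assume c: "c \<in> A"
    have "0 = ((\<Sum>c\<in>A. (grad (\<phi> c) x \<bullet> v) *\<^sub>R a c) + unused_coordinates A a u) \<bullet> a c"
      using act by simp
    also have "\<dots> = grad (\<phi> c) x \<bullet> v"
      unfolding inner_add_left
      using inner_sum_Basis_family[OF a c, of "\<lambda>c. grad (\<phi> c) x \<bullet> v"]
        unused_coordinates_inner[OF a c] by simp
    finally show "grad (\<phi> c) x \<bullet> v = 0" by simp
  qed
  have vH: "v v* ?H = (\<Sum>c\<in>A. (u \<bullet> a c) *\<^sub>R grad (\<phi> c) x)"
  proof -
    have "p - q = r" if "p - (q + r) = 0" for p q r :: "real^'n"
      using that by (simp add: algebra_simps)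
    from this[OF stat[unfolded sum.distrib]] show ?thesis
      unfolding vector_matrix_mult_linear_combination .
  qed
  have "v = 0"
  proof (rule nonsing[OF tang])
    fix y assume "\<forall>c\<in>A. grad (\<phi> c) x \<bullet> y = 0"
    then show "v \<bullet> (?H *v y) = 0"
      unfolding dot_lmul_matrix[symmetric] vH by (simp add: inner_sum_left)
  qed
  then have "(\<Sum>c\<in>A. (u \<bullet> a c) *\<^sub>R grad (\<phi> c) x) = 0"
    using vH by simp
  from indep[OF this] have "\<forall>c\<in>A. u \<bullet> a c = 0" .
  then have "unused_coordinates A a u = u"
    by (simp add: unused_coordinates_def)
  moreover have "unused_coordinates A a u = 0"
    using act tang by simp
  ultimately show ?thesis using \<open>v = 0\<close> by simp
qed

section \<open>Stationarity in terms of a single family of multipliers\<close>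

definition all_cons :: "'i set \<Rightarrow> 'j set \<Rightarrow> nat \<Rightarrow> ('i, 'j) con set" where
  "all_cons I J k = Eq ` I \<union> Ineq ` J \<union> Sw1 ` {1..k} \<union> Sw2 ` {1..k}"

lemma finite_all_cons: "finite I \<Longrightarrow> finite J \<Longrightarrow> finite (all_cons I J k)"
  by (simp add: all_cons_def)

lemma components_conv: "components I J k P = insert (obj P) (con_fun P ` all_cons I J k)"
  by (auto simp: components_def all_cons_def image_Un image_image)

lemma con_fun_mpsc_diff: "con_fun (mpsc_diff P Q) c = (\<lambda>x. con_fun P c x - con_fun Q c x)"
  by (cases c) (simp_all add: mpsc_diff_def)

lemma obj_mpsc_diff: "obj (mpsc_diff P Q) = (\<lambda>x. obj P x - obj Q x)"
  by (simp add: mpsc_diff_def)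

lemma sum_all_cons:
  fixes h :: "('i, 'j) con \<Rightarrow> 'a::comm_monoid_add"
  assumes "finite I" "finite J"
  shows "sum h (all_cons I J k) = (\<Sum>i\<in>I. h (Eq i)) + (\<Sum>j\<in>J. h (Ineq j)) +
    (\<Sum>m=1..k. h (Sw1 m) + h (Sw2 m))"
proof -
  have "sum h (all_cons I J k) = sum h (Eq ` I \<union> Ineq ` J \<union> Sw1 ` {1..k}) + sum h (Sw2 ` {1..k})"
    unfolding all_cons_def by (rule sum.union_disjoint) (use assms in auto)
  also have "sum h (Eq ` I \<union> Ineq ` J \<union> Sw1 ` {1..k}) = sum h (Eq ` I \<union> Ineq ` J) + sum h (Sw1 ` {1..k})"
    by (rule sum.union_disjoint) (use assms in auto)
  also have "sum h (Eq ` I \<union> Ineq ` J) = sum h (Eq ` I) + sum h (Ineq ` J)"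
    by (rule sum.union_disjoint) (use assms in auto)
  finally show ?thesis
    by (simp add: sum.reindex inj_on_def sum.distrib add.assoc)
qed

text \<open>Collecting the four kinds of multipliers in one function on constraints allows uniform sums over
  \<open>all_cons\<close> and over its subset of active constraints.\<close>

definition W_multiplier ::
  "'i set \<Rightarrow> 'j set \<Rightarrow> nat \<Rightarrow> ('n::finite, 'i, 'j) mpsc \<Rightarrow> real^'n \<Rightarrow> (('i, 'j) con \<Rightarrow> real) \<Rightarrow> bool"
  where
  "W_multiplier I J k P x \<Lambda> \<longleftrightarrow>
     x \<in> feasible_set I J k P \<and>
     grad (obj P) x = (\<Sum>c\<in>all_cons I J k. \<Lambda> c *\<^sub>R grad (con_fun P c) x) \<and>
     (\<forall>c\<in>all_cons I J k. \<Lambda> c * con_fun P c x = 0) \<and> (\<forall>j\<in>J. \<Lambda> (Ineq j) \<ge> 0)"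

lemma W_stationary_with_iff:
  assumes "finite I" "finite J"
  shows "W_stationary_with I J k P x lam \<mu> \<sigma>1 \<sigma>2 \<longleftrightarrow>
    W_multiplier I J k P x (case_con lam \<mu> \<sigma>1 \<sigma>2)"
  unfolding W_stationary_with_def W_multiplier_def sum_all_cons[OF assms]
  by (auto simp: all_cons_def feasible_set_def ball_Un)

lemma W_stationary_iff:
  assumes "finite I" "finite J"
  shows "W_stationary I J k P x \<longleftrightarrow> (\<exists>\<Lambda>. W_multiplier I J k P x \<Lambda>)"
proof
  assume "\<exists>\<Lambda>. W_multiplier I J k P x \<Lambda>"
  then obtain \<Lambda> where "W_multiplier I J k P x \<Lambda>" ..
  moreover have "case_con (\<lambda>i. \<Lambda> (Eq i)) (\<lambda>j. \<Lambda> (Ineq j)) (\<lambda>m. \<Lambda> (Sw1 m)) (\<lambda>m. \<Lambda> (Sw2 m)) = \<Lambda>"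
    by (auto simp: fun_eq_iff split: con.split)
  ultimately have "W_stationary_with I J k P x
      (\<lambda>i. \<Lambda> (Eq i)) (\<lambda>j. \<Lambda> (Ineq j)) (\<lambda>m. \<Lambda> (Sw1 m)) (\<lambda>m. \<Lambda> (Sw2 m))"
    by (simp only: W_stationary_with_iff[OF assms])
  then show "W_stationary I J k P x"
    unfolding W_stationary_def by blast
qed (auto simp: W_stationary_def W_stationary_with_iff[OF assms])

lemma Lagrangian_conv:
  assumes "finite I" "finite J"
  shows "Lagrangian I J k P lam \<mu> \<sigma>1 \<sigma>2 =
    (\<lambda>x. obj P x - (\<Sum>c\<in>all_cons I J k. case_con lam \<mu> \<sigma>1 \<sigma>2 c * con_fun P c x))"
  by (simp add: fun_eq_iff Lagrangian_def sum_all_cons[OF assms])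

lemma mem_all_cons [simp]:
  "Eq i \<in> all_cons I J k \<longleftrightarrow> i \<in> I" "Ineq j \<in> all_cons I J k \<longleftrightarrow> j \<in> J"
  "Sw1 m \<in> all_cons I J k \<longleftrightarrow> m \<in> {1..k}" "Sw2 m \<in> all_cons I J k \<longleftrightarrow> m \<in> {1..k}"
  by (auto simp: all_cons_def)

lemma mem_active_cons [simp]:
  "Eq i \<in> active_cons I J k P x \<longleftrightarrow> i \<in> I"
  "Ineq j \<in> active_cons I J k P x \<longleftrightarrow> j \<in> J \<and> ineqs P j x = 0"
  "Sw1 m \<in> active_cons I J k P x \<longleftrightarrow> m \<in> {1..k} \<and> sw1 P m x = 0"
  "Sw2 m \<in> active_cons I J k P x \<longleftrightarrow> m \<in> {1..k} \<and> sw2 P m x = 0"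
  unfolding active_cons_def J0_def alpha_set_def beta_set_def gamma_set_def by blast+

lemma active_cons_conv:
  assumes "x \<in> feasible_set I J k P"
  shows "active_cons I J k P x = {c \<in> all_cons I J k. con_fun P c x = 0}"
proof (rule Set.set_eqI)
  fix c
  show "c \<in> active_cons I J k P x \<longleftrightarrow> c \<in> {c \<in> all_cons I J k. con_fun P c x = 0}"
    using assms by (cases c) (auto simp: feasible_set_def)
qed

lemma tangent_space_conv:
  "tangent_space I J k P x = {\<xi>. \<forall>c\<in>active_cons I J k P x. grad (con_fun P c) x \<bullet> \<xi> = 0}"
  by (auto simp: tangent_space_def active_cons_def ball_Un)

lemma LICQ_linearly_independent:
  assumes "LICQ I J k P x" and "(\<Sum>c\<in>active_cons I J k P x. t c *\<^sub>R grad (con_fun P c) x) = 0"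
  shows "\<forall>c\<in>active_cons I J k P x. t c = 0"
proof -
  let ?A = "active_cons I J k P x" and ?g = "\<lambda>c. grad (con_fun P c) x"
  have inj: "inj_on ?g ?A" and ind: "independent (?g ` ?A)"
    using assms(1) by (auto simp: LICQ_def)
  let ?u = "\<lambda>v. t (the_inv_into ?A ?g v)"
  have u: "?u (?g c) = t c" if "c \<in> ?A" for c
    by (simp only: the_inv_into_f_f[OF inj that])
  have "(\<Sum>v\<in>?g ` ?A. ?u v *\<^sub>R v) = (\<Sum>c\<in>?A. t c *\<^sub>R ?g c)"
    unfolding sum.reindex[OF inj] comp_def by (intro sum.cong refl) (simp only: u)
  with assms(2) have "(\<Sum>v\<in>?g ` ?A. ?u v *\<^sub>R v) = 0" by (simp only:)
  from independentD[OF ind independent_imp_finite[OF ind] subset_refl this imageI] u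
  show ?thesis by metis
qed

text \<open>Independence bounds the number of active constraints by the dimension. The multipliers
  of the active constraints can therefore be stored in the coordinates of a single vector of
  the same space as \<open>x\<close>.\<close>

lemma LICQ_coordinates:
  fixes P :: "('n::finite, 'i, 'j) mpsc"
  assumes "LICQ I J k P x"
  obtains a :: "('i, 'j) con \<Rightarrow> real^'n"
  where "inj_on a (active_cons I J k P x)" "a ` active_cons I J k P x \<subseteq> Basis"
proof -
  let ?A = "active_cons I J k P x" and ?g = "\<lambda>c. grad (con_fun P c) x"
  have inj: "inj_on ?g ?A" and ind: "independent (?g ` ?A)"
    using assms(1) by (auto simp: LICQ_def)
  have "finite (?g ` ?A)" "card (?g ` ?A) \<le> DIM(real^'n)"
    using independent_bound[OF ind] by auto
  then have "finite ?A" "card ?A \<le> card (Basis :: (real^'n) set)"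
    using inj by (auto simp: card_image finite_image_iff)
  from card_le_inj[OF this(1) finite_Basis this(2)] show ?thesis
    using that by blast
qed

text \<open>If \<open>q\<close> is the coordinate vector of \<open>v\<close> in the basis \<open>V\<close>, then testing with the columns of \<open>V\<close> says
  that \<open>q\<^sup>T (V\<^sup>T H V) = 0\<close>, and a right inverse of the restricted matrix gives \<open>q = 0\<close>.\<close>

lemma nonsingular_on_left_null_vector:
  assumes "nonsingular_on H T" and "v \<in> T" and null: "\<And>y. y \<in> T \<Longrightarrow> v \<bullet> (H *v y) = 0"
  shows "v = 0"
proof -
  obtain vs where vs: "distinct vs" "span (set vs) = T"
    and inv: "invertible_mat (restricted_matrix H vs)"
    using assms(1) by (auto simp: nonsingular_on_def is_basis_list_def)
  let ?n = "length vs" and ?M = "restricted_matrix H vs"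
  have dimM: "?M \<in> carrier_mat ?n ?n" by (simp add: restricted_matrix_def)
  obtain B where MB: "?M * B = 1\<^sub>m ?n" and BM: "B * ?M = 1\<^sub>m (dim_row B)"
    using inv dimM by (auto simp: invertible_mat_def inverts_mat_def)
  have dimB: "B \<in> carrier_mat ?n ?n"
    using arg_cong[OF MB, of dim_col] arg_cong[OF BM, of dim_col] dimM by auto
  obtain q where "v = (\<Sum>w\<in>set vs. q w *\<^sub>R w)"
    using \<open>v \<in> T\<close> span_finite[of "set vs"] vs(2) by auto
  then have v: "v = (\<Sum>i<?n. q (vs ! i) *\<^sub>R vs ! i)"
    using sum.reindex_bij_betw[OF bij_betw_nth[OF vs(1) refl refl], of "\<lambda>w. q w *\<^sub>R w"] by simp
  have row: "(\<Sum>i<?n. q (vs ! i) * ?M $$ (i, j)) = 0" if "j < ?n" for j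
  proof -
    have "vs ! j \<in> T" using that vs(2) span_superset nth_mem by blast
    from null[OF this] show ?thesis
      using that by (simp add: v inner_sum_left restricted_matrix_def)
  qed
  have "q (vs ! l) = 0" if l: "l < ?n" for l
  proof -
    have "q (vs ! l) = (\<Sum>i<?n. if i = l then q (vs ! i) else 0)"
      using l by simp
    also have "\<dots> = (\<Sum>i<?n. q (vs ! i) * (?M * B) $$ (i, l))"
      using l unfolding MB by (intro sum.cong) auto
    also have "\<dots> = (\<Sum>i<?n. q (vs ! i) * (\<Sum>j<?n. ?M $$ (i, j) * B $$ (j, l)))"
      using l dimM dimB
      by (intro sum.cong refl)
         (auto simp: Matrix.scalar_prod_def Matrix.row_def Matrix.col_def lessThan_atLeast0)
    also have "\<dots> = (\<Sum>j<?n. (\<Sum>i<?n. q (vs ! i) * ?M $$ (i, j)) * B $$ (j, l))"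
      unfolding sum_distrib_left sum_distrib_right by (subst sum.swap) (simp add: mult.assoc)
    also have "\<dots> = 0" using row by simp
    finally show ?thesis .
  qed
  then show "v = 0" by (simp add: v)
qed

section \<open>Stationary points of a perturbed problem as zeros of its system\<close>

lemma all_cons_cases:
  assumes "c \<in> all_cons I J k"
  obtains i where "c = Eq i" "i \<in> I" | j where "c = Ineq j" "j \<in> J"
    | m where "c = Sw1 m" "m \<in> {1..k}" | m where "c = Sw2 m" "m \<in> {1..k}"
  using assms by (auto simp: all_cons_def)

text \<open>In the next three lemmas, \<open>Q\<close> is thought of as a perturbation of \<open>P\<close>, considered at a point close
  to \<open>x0\<close>. All that matters of this closeness is that the constraints that do not vanish for \<open>P\<close> at
  \<open>x0\<close> keep their sign. Then inactive inequalities remain satisfied, and as every switching pair has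
  a factor in \<open>A\<close>, a zero of the system is feasible.\<close>

lemma kkt_zero_imp_W_stationary:
  assumes fin: "finite I" "finite J" and feas: "x0 \<in> feasible_set I J k P"
  defines "A \<equiv> active_cons I J k P x0"
  assumes a: "finite A" "inj_on a A" "a ` A \<subseteq> Basis"
    and sign: "\<And>c. c \<in> all_cons I J k \<Longrightarrow> c \<notin> A \<Longrightarrow> 0 < con_fun P c x0 * con_fun Q c x"
    and zero: "kkt_system A a (obj Q) (con_fun Q) (x, w) = 0"
    and pos: "\<And>j. Ineq j \<in> A \<Longrightarrow> 0 \<le> w \<bullet> a (Ineq j)"
  shows "W_stationary I J k Q x"
proof -
  define \<Lambda> where "\<Lambda> c = (if c \<in> A then w \<bullet> a c else 0)" for c
  have sub: "A \<subseteq> all_cons I J k"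
    unfolding A_def active_cons_conv[OF feas] by blast
  have gr: "grad (obj Q) x = (\<Sum>c\<in>A. (w \<bullet> a c) *\<^sub>R grad (con_fun Q c) x)"
    and act: "\<And>c. c \<in> A \<Longrightarrow> con_fun Q c x = 0"
    using zero unfolding kkt_system_eq_0_iff[OF a] by auto
  have "(\<Sum>c\<in>all_cons I J k. \<Lambda> c *\<^sub>R grad (con_fun Q c) x)
      = (\<Sum>c\<in>A. (w \<bullet> a c) *\<^sub>R grad (con_fun Q c) x)"
    using sub finite_all_cons[OF fin] by (intro sum.mono_neutral_cong_right) (auto simp: \<Lambda>_def)
  moreover have "x \<in> feasible_set I J k Q"
    unfolding feasible_set_def
  proof (intro CollectI conjI ballI)
    fix i assume "i \<in> I"
    then show "eqs Q i x = 0" using act[of "Eq i"] by (simp add: A_def)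
  next
    fix j assume j: "j \<in> J"
    show "0 \<le> ineqs Q j x"
    proof (cases "Ineq j \<in> A")
      case True
      then show ?thesis using act[of "Ineq j"] by simp
    next
      case False
      have "0 \<le> ineqs P j x0" using feas j by (simp add: feasible_set_def)
      with sign[of "Ineq j"] False j show ?thesis by (auto simp: zero_less_mult_iff)
    qed
  next
    fix m assume m: "m \<in> {1..k}"
    then have "sw1 P m x0 = 0 \<or> sw2 P m x0 = 0" using feas by (simp add: feasible_set_def)
    then have "Sw1 m \<in> A \<or> Sw2 m \<in> A" using m by (simp add: A_def)
    then show "sw1 Q m x * sw2 Q m x = 0" using act[of "Sw1 m"] act[of "Sw2 m"] by auto
  qed
  moreover have "\<Lambda> c * con_fun Q c x = 0" for c
    using act by (simp add: \<Lambda>_def)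
  moreover have "0 \<le> \<Lambda> (Ineq j)" for j
    using pos by (simp add: \<Lambda>_def)
  ultimately have "W_multiplier I J k Q x \<Lambda>"
    using gr by (simp add: W_multiplier_def)
  then show ?thesis unfolding W_stationary_iff[OF fin] by blast
qed

text \<open>Complementarity removes the constraints outside \<open>A\<close>, which do not vanish at \<open>y\<close>.\<close>

lemma W_multiplier_inactive:
  assumes fin: "finite I" "finite J" and feas: "x0 \<in> feasible_set I J k P"
  defines "A \<equiv> active_cons I J k P x0"
  assumes sign: "\<And>c. c \<in> all_cons I J k \<Longrightarrow> c \<notin> A \<Longrightarrow> 0 < con_fun P c x0 * con_fun Q c y"
    and \<Lambda>: "W_multiplier I J k Q y \<Lambda>"
  shows "grad (obj Q) y = (\<Sum>c\<in>A. \<Lambda> c *\<^sub>R grad (con_fun Q c) y)"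
proof -
  have "A \<subseteq> all_cons I J k"
    unfolding A_def active_cons_conv[OF feas] by blast
  moreover have "\<Lambda> c = 0" if "c \<in> all_cons I J k - A" for c
  proof -
    have "con_fun Q c y \<noteq> 0" using sign[of c] that by force
    moreover have "\<Lambda> c * con_fun Q c y = 0" using \<Lambda> that by (simp add: W_multiplier_def)
    ultimately show ?thesis by simp
  qed
  ultimately have "(\<Sum>c\<in>all_cons I J k. \<Lambda> c *\<^sub>R grad (con_fun Q c) y)
      = (\<Sum>c\<in>A. \<Lambda> c *\<^sub>R grad (con_fun Q c) y)"
    using finite_all_cons[OF fin] by (intro sum.mono_neutral_right) auto
  with \<Lambda> show ?thesis by (simp add: W_multiplier_def)
qed

text \<open>Nonzero multipliers make biactive constraints and active inequalities of \<open>P\<close> active for \<open>Q\<close>;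
  in a switching pair with one nonvanishing factor, feasibility forces the other factor to be
  zero.\<close>

lemma W_multiplier_active:
  assumes feas: "x0 \<in> feasible_set I J k P"
  defines "A \<equiv> active_cons I J k P x0"
  assumes sign: "\<And>c. c \<in> all_cons I J k \<Longrightarrow> c \<notin> A \<Longrightarrow> 0 < con_fun P c x0 * con_fun Q c y"
    and \<Lambda>: "W_multiplier I J k Q y \<Lambda>"
    and Ineq: "\<And>j. Ineq j \<in> A \<Longrightarrow> \<Lambda> (Ineq j) \<noteq> 0"
    and Sw: "\<And>m. Sw1 m \<in> A \<Longrightarrow> Sw2 m \<in> A \<Longrightarrow> \<Lambda> (Sw1 m) \<noteq> 0 \<and> \<Lambda> (Sw2 m) \<noteq> 0"
    and c: "c \<in> A"
  shows "con_fun Q c y = 0"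
proof -
  have all: "c \<in> all_cons I J k"
    using c unfolding A_def active_cons_conv[OF feas] by blast
  have feasQ: "y \<in> feasible_set I J k Q"
    and compl: "\<And>c. c \<in> all_cons I J k \<Longrightarrow> \<Lambda> c * con_fun Q c y = 0"
    using \<Lambda> by (auto simp: W_multiplier_def)
  from all show ?thesis
  proof (cases rule: all_cons_cases)
    case (1 i)
    then show ?thesis using feasQ by (simp add: feasible_set_def)
  next
    case (2 j)
    then show ?thesis using compl[OF all] Ineq c by auto
  next
    case (3 m)
    show ?thesis
    proof (cases "Sw2 m \<in> A")
      case True
      then show ?thesis using compl[OF all] Sw c 3 by auto
    next
      case False
      then have "sw2 Q m y \<noteq> 0" using sign[of "Sw2 m"] 3 by auto
      then show ?thesis using feasQ 3 by (auto simp: feasible_set_def)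
    qed
  next
    case (4 m)
    show ?thesis
    proof (cases "Sw1 m \<in> A")
      case True
      then show ?thesis using compl[OF all] Sw c 4 by auto
    next
      case False
      then have "sw1 Q m y \<noteq> 0" using sign[of "Sw1 m"] 4 by auto
      then show ?thesis using feasQ 4 by (auto simp: feasible_set_def)
    qed
  qed
qed

lemma kkt_system_affine:
  "kkt_system A a f \<phi> (y, w0 + t *\<^sub>R (w - w0)) - kkt_system A a f \<phi> (y, w0)
    = t *\<^sub>R (kkt_system A a f \<phi> (y, w) - kkt_system A a f \<phi> (y, w0))"
proof -
  let ?g = "\<lambda>c. grad (\<phi> c) y" and ?u = "unused_coordinates A a"
  have 1: "(\<Sum>c\<in>A. ((w0 + t *\<^sub>R (w - w0)) \<bullet> a c) *\<^sub>R ?g c)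
      = (\<Sum>c\<in>A. (w0 \<bullet> a c) *\<^sub>R ?g c) + t *\<^sub>R ((\<Sum>c\<in>A. (w \<bullet> a c) *\<^sub>R ?g c) - (\<Sum>c\<in>A. (w0 \<bullet> a c) *\<^sub>R ?g c))"
    by (simp add: inner_add_left inner_diff_left scaleR_left_distrib scaleR_left_diff_distrib
        sum.distrib sum_subtractf scaleR_sum_right scaleR_right_diff_distrib right_diff_distrib)
  have 2: "?u (w0 + t *\<^sub>R (w - w0)) = ?u w0 + t *\<^sub>R (?u w - ?u w0)"
    by (simp only: linear_add linear_diff linear_scale linear_unused_coordinates)
  show ?thesis
    unfolding kkt_system_def kkt_map_def fst_conv snd_conv 1 2
    by (simp add: algebra_simps)
qed

text \<open>Expansion is known only for multipliers near \<open>w0\<close>, while \<open>w\<close> might be far away. But the system is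
  affine in the multipliers, so that expansion on an initial piece of the segment from \<open>w0\<close> to \<open>w\<close>
  extends to the whole segment; and as \<open>w\<close> solves the stationarity equations at \<open>y\<close>, the difference
  of the values at its ends is bounded by the residual of \<open>w0\<close>.\<close>

lemma multiplier_near:
  fixes w w0 :: "real^'n::finite"
  assumes expand: "\<And>v. v \<in> cball w0 \<rho> \<Longrightarrow>
      e * norm (v - w0) \<le> norm (kkt_system A a f \<phi> (y, v) - kkt_system A a f \<phi> (y, w0))"
    and "e > 0" and "\<rho> > 0"
    and stat: "grad f y = (\<Sum>c\<in>A. (w \<bullet> a c) *\<^sub>R grad (\<phi> c) y)"
    and unused: "unused_coordinates A a w = 0" "unused_coordinates A a w0 = 0"
    and residual: "norm (kkt_system A a f \<phi> (y, w0)) \<le> e * \<rho>"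
  shows "w \<in> cball w0 \<rho>"
proof (rule ccontr)
  let ?G = "kkt_system A a f \<phi>"
  assume "w \<notin> cball w0 \<rho>"
  then have far: "\<rho> < norm (w - w0)" by (simp add: dist_norm norm_minus_commute)
  define t where "t = \<rho> / norm (w - w0)"
  have pos: "0 < norm (w - w0)" using far \<open>\<rho> > 0\<close> by linarith
  then have t: "0 < t" "t < 1"
    using far \<open>\<rho> > 0\<close> by (simp_all only: t_def divide_pos_pos divide_less_eq_1_pos)
  have len: "norm (w0 + t *\<^sub>R (w - w0) - w0) = \<rho>"
    using pos \<open>\<rho> > 0\<close> by (simp add: t_def)
  have "?G (y, w) - ?G (y, w0) = (- fst (?G (y, w0)), 0)"
    using stat unused by (simp add: kkt_system_def kkt_map_def)
  then have diff: "norm (?G (y, w) - ?G (y, w0)) \<le> norm (?G (y, w0))"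
    using norm_fst_le[of "fst (?G (y, w0))" "snd (?G (y, w0))"] by (simp add: norm_Pair)
  have "w0 + t *\<^sub>R (w - w0) \<in> cball w0 \<rho>" using len by (simp add: dist_norm)
  from expand[OF this] have "e * \<rho> \<le> t * norm (?G (y, w) - ?G (y, w0))"
    unfolding len kkt_system_affine using t by simp
  also have "\<dots> \<le> t * (e * \<rho>)"
    using diff residual t by (intro mult_left_mono) auto
  also have "\<dots> < e * \<rho>" using t \<open>e > 0\<close> \<open>\<rho> > 0\<close> by simp
  finally show False by simp
qed

section \<open>Strong stability\<close>

lemma finite_positive_lower_bound:
  fixes h :: "'c \<Rightarrow> real"
  assumes "finite S" "\<And>s. s \<in> S \<Longrightarrow> 0 < h s"
  obtains d where "d > 0" "\<And>s. s \<in> S \<Longrightarrow> d \<le> h s"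
proof
  show "0 < Min (insert 1 (h ` S))" using assms by simp
  show "Min (insert 1 (h ` S)) \<le> h s" if "s \<in> S" for s using assms(1) that by simp
qed

theorem corollary4p2:
  fixes I :: "'i set" and J :: "'j set" and k :: nat
    and P :: "('n::finite, 'i, 'j) mpsc" and x0 :: "real^'n"
  assumes "finite I" and "finite J"
    and "C2_mpsc I J k P"
    and "nondegenerate I J k P x0"
  shows "strongly_stable I J k P x0"
proof -
  let ?C = "all_cons I J k"
  define A where "A = active_cons I J k P x0"
  note fin = assms(1,2)
  have finC: "finite ?C" using finite_all_cons[OF fin] .
  have C2: "C2 (obj R)" "\<And>c. c \<in> ?C \<Longrightarrow> C2 (con_fun R c)" if "C2_mpsc I J k R"
    for R :: "('n, 'i, 'j) mpsc"
    using that by (auto simp: C2_mpsc_def components_conv)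
  note C2P = C2[OF assms(3)]
  obtain lam \<mu> \<sigma>1 \<sigma>2 where stat_with: "W_stationary_with I J k P x0 lam \<mu> \<sigma>1 \<sigma>2"
    and licq: "LICQ I J k P x0"
    and ND2: "\<And>j. j \<in> J0 J P x0 \<Longrightarrow> \<mu> j > 0"
    and ND3: "\<And>m. m \<in> beta_set k P x0 \<Longrightarrow> \<sigma>1 m * \<sigma>2 m \<noteq> 0"
    and ND4: "nonsingular_on (hessian (Lagrangian I J k P lam \<mu> \<sigma>1 \<sigma>2) x0) (tangent_space I J k P x0)"
    using assms(4) by (auto simp: nondegenerate_def)
  define \<Lambda>0 where "\<Lambda>0 = case_con lam \<mu> \<sigma>1 \<sigma>2"
  have mult: "W_multiplier I J k P x0 \<Lambda>0"
    using stat_with by (simp add: W_stationary_with_iff[OF fin] \<Lambda>0_def)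
  then have feas: "x0 \<in> feasible_set I J k P" by (simp add: W_multiplier_def)
  have A_conv: "A = {c \<in> ?C. con_fun P c x0 = 0}"
    unfolding A_def by (rule active_cons_conv[OF feas])
  then have subC: "A \<subseteq> ?C" by blast
  have finA: "finite A" using subC finC finite_subset by blast
  have off: "\<Lambda>0 c = 0" if "c \<in> ?C - A" for c
    using mult that by (auto simp: W_multiplier_def A_conv)
  have C2A: "\<And>c. c \<in> A \<Longrightarrow> C2 (con_fun P c)" using C2P(2) subC by blast
  obtain a :: "('i, 'j) con \<Rightarrow> real^'n" where "inj_on a A" "a ` A \<subseteq> Basis"
    using LICQ_coordinates[OF licq] unfolding A_def by blast
  note a = finA this
  have norm_a: "norm (a c) \<le> 1" if "c \<in> A" for c
    using a(3) that norm_Basis by (metis image_subset_iff order_refl)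

  (* The system for P, its zero (x0, w0), and its linearization T there. *)
  define w0 where "w0 = (\<Sum>c\<in>A. \<Lambda>0 c *\<^sub>R a c)"
  have w0: "w0 \<bullet> a c = \<Lambda>0 c" if "c \<in> A" for c
    unfolding w0_def by (rule inner_sum_Basis_family[OF a that])
  have unused_sum: "unused_coordinates A a (\<Sum>c\<in>A. t c *\<^sub>R a c) = 0" for t
    by (simp add: unused_coordinates_def inner_sum_Basis_family[OF a])
  define G where "G = kkt_system A a (obj P) (con_fun P)"
  define T where "T = kkt_system_deriv A a (obj P) (con_fun P) (x0, w0)"
  have G0: "G (x0, w0) = 0"
    unfolding G_def kkt_system_eq_0_iff[OF a]
  proof (intro conjI ballI)
    show "grad (obj P) x0 = (\<Sum>c\<in>A. (w0 \<bullet> a c) *\<^sub>R grad (con_fun P c) x0)"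
    proof -
      have "grad (obj P) x0 = (\<Sum>c\<in>?C. \<Lambda>0 c *\<^sub>R grad (con_fun P c) x0)"
        using mult by (simp add: W_multiplier_def)
      also have "\<dots> = (\<Sum>c\<in>A. (w0 \<bullet> a c) *\<^sub>R grad (con_fun P c) x0)"
        using subC finC off by (intro sum.mono_neutral_cong_right) (auto simp: w0)
      finally show ?thesis .
    qed
    show "con_fun P c x0 = 0" if "c \<in> A" for c using that A_conv by blast
    show "unused_coordinates A a w0 = 0" unfolding w0_def by (rule unused_sum)
  qed
  have derG: "(G has_derivative kkt_system_deriv A a (obj P) (con_fun P) z) (at z)" for z
    unfolding G_def by (rule kkt_system_has_derivative[OF C2P(1) C2A])
  then have linT: "linear T"
    unfolding T_def by (rule has_derivative_linear)
  have "hessian (Lagrangian I J k P lam \<mu> \<sigma>1 \<sigma>2) x0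
      = hessian (obj P) x0 - (\<Sum>c\<in>?C. \<Lambda>0 c *\<^sub>R hessian (con_fun P c) x0)"
    unfolding Lagrangian_conv[OF fin] \<Lambda>0_def[symmetric]
    using C2_linear_combination(3)[where f = "obj P" and \<phi> = "con_fun P" and A = ?C, OF C2P] by simp
  also have "(\<Sum>c\<in>?C. \<Lambda>0 c *\<^sub>R hessian (con_fun P c) x0)
      = (\<Sum>c\<in>A. (w0 \<bullet> a c) *\<^sub>R hessian (con_fun P c) x0)"
    using subC finC off by (intro sum.mono_neutral_cong_right) (auto simp: w0)
  finally have hess: "hessian (Lagrangian I J k P lam \<mu> \<sigma>1 \<sigma>2) x0
      = hessian (obj P) x0 - (\<Sum>c\<in>A. (w0 \<bullet> a c) *\<^sub>R hessian (con_fun P c) x0)" .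
  have "inj T"
    unfolding linear_injective_0[OF linT]
  proof (intro allI impI)
    fix h assume "T h = 0"
    then have "kkt_system_deriv A a (obj P) (con_fun P) (x0, w0) (fst h, snd h) = 0"
      by (simp add: T_def)
    from kkt_system_deriv_injective[OF a _ _ this]
    have "fst h = 0 \<and> snd h = 0"
      using LICQ_linearly_independent[OF licq] nonsingular_on_left_null_vector[OF ND4]
      unfolding tangent_space_conv hess A_def[symmetric] by blast
    then show "h = 0" by (simp add: prod_eq_iff)
  qed
  then obtain m where "m > 0" and m: "\<And>v. m * norm v \<le> norm (T v)"
    using linear_inj_bounded_below_pos[OF linT] by blast
  obtain B where "B > 0" and B: "\<And>v. norm (T v) \<le> B * norm v"
    using linear_bounded_pos[OF linT] by blast

  (* The radius rho for the multipliers: T approximates the system up to m / 4, which leaves another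
     m / 4 for the perturbation, and nonzero multipliers keep their sign. *)
  define D where "D = kkt_system_deriv A a (obj P) (con_fun P)"
  obtain \<rho>1 where "\<rho>1 > 0" and \<rho>1: "\<And>z z'. z \<in> cball (x0, w0) \<rho>1 \<Longrightarrow> z' \<in> cball (x0, w0) \<rho>1 \<Longrightarrow>
      norm (G z - G z' - T (z - z')) \<le> m / 4 * norm (z - z')"
  proof (rule strictly_differentiable[where F = G and D = D and ?z0.0 = "(x0, w0)" and \<eta> = "m / 4"])
    show "(G has_derivative D z) (at z)" for z
      unfolding D_def by (rule derG)
    show "isCont (\<lambda>z. D z b) (x0, w0)" for b
      unfolding D_def by (rule kkt_system_deriv_continuous[OF C2P(1) C2A])
    show "0 < m / 4" using \<open>m > 0\<close> by simp
  qed (rule that, simp_all only: T_def D_def)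
  obtain \<rho>2 where "\<rho>2 > 0" and \<rho>2: "\<And>c. c \<in> {c \<in> A. \<Lambda>0 c \<noteq> 0} \<Longrightarrow> \<rho>2 \<le> \<bar>\<Lambda>0 c\<bar> / 2"
    by (rule finite_positive_lower_bound[of "{c \<in> A. \<Lambda>0 c \<noteq> 0}" "\<lambda>c. \<bar>\<Lambda>0 c\<bar> / 2"])
       (use finA in auto)
  define \<rho> where "\<rho> = min (\<rho>1 / 2) \<rho>2"
  have \<rho>: "0 < \<rho>" "\<rho> \<le> \<rho>1 / 2" "\<rho> \<le> \<rho>2"
    using \<open>\<rho>1 > 0\<close> \<open>\<rho>2 > 0\<close> by (auto simp: \<rho>_def)
  (* A third of the nonvanishing values goes to the variation of x, another third to the perturbation
     of the data; the rest keeps the sign. *)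
  obtain \<theta> where "\<theta> > 0" and \<theta>: "\<And>c. c \<in> ?C - A \<Longrightarrow> \<theta> \<le> \<bar>con_fun P c x0\<bar> / 3"
    by (rule finite_positive_lower_bound[of "?C - A" "\<lambda>c. \<bar>con_fun P c x0\<bar> / 3"])
       (use finC A_conv in auto)
  have "\<forall>\<^sub>F x in at x0. \<forall>c\<in>?C - A. dist (con_fun P c x) (con_fun P c x0) < \<theta>"
  proof (rule eventually_ball_finite)
    show "finite (?C - A)" using finC by simp
    show "\<forall>c\<in>?C - A. \<forall>\<^sub>F x in at x0. dist (con_fun P c x) (con_fun P c x0) < \<theta>"
    proof
      fix c assume "c \<in> ?C - A"
      then have "isCont (con_fun P c) x0"
        using C2_has_derivative[OF C2P(2)] has_derivative_continuous by blast
      then show "\<forall>\<^sub>F x in at x0. dist (con_fun P c x) (con_fun P c x0) < \<theta>"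
        using \<open>\<theta> > 0\<close> by (auto simp: isCont_def tendsto_iff)
    qed
  qed
  then obtain r1 where "r1 > 0" and "\<forall>x. x \<noteq> x0 \<and> dist x x0 < r1 \<longrightarrow>
      (\<forall>c\<in>?C - A. dist (con_fun P c x) (con_fun P c x0) < \<theta>)"
    unfolding eventually_at by auto
  then have r1: "\<bar>con_fun P c x - con_fun P c x0\<bar> < \<theta>" if "dist x x0 < r1" "c \<in> ?C - A" for x c
    using that \<open>\<theta> > 0\<close> by (cases "x = x0") (auto simp: dist_real_def)

  (* With this r the system, which grows at rate at most B + m / 2, stays so small on the ball around x0
     that the residual of w0 meets the bound in multiplier_near. *)
  define r where "r = min (\<rho> / 2) (min (r1 / 2) (m * \<rho> / 4 / (B + m / 2)))"
  have "B + m / 2 > 0" using \<open>B > 0\<close> \<open>m > 0\<close> by simp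
  have r: "0 < r" "r \<le> \<rho> / 2" "r < r1" "(B + m / 2) * r \<le> m * \<rho> / 4"
  proof -
    show "0 < r" using \<rho> \<open>r1 > 0\<close> \<open>m > 0\<close> \<open>B + m / 2 > 0\<close> by (simp add: r_def)
    have "r \<le> \<rho> / 2 \<and> r \<le> r1 / 2 \<and> r \<le> m * \<rho> / 4 / (B + m / 2)"
      unfolding r_def by (intro conjI min.cobounded1 min.cobounded2 min.coboundedI2)
    then show "r \<le> \<rho> / 2" "r < r1" "(B + m / 2) * r \<le> m * \<rho> / 4"
      using \<open>r1 > 0\<close> pos_le_divide_eq[OF \<open>B + m / 2 > 0\<close>] by (auto simp only: mult.commute)
  qed
  define U where "U = cball x0 r \<times> cball w0 \<rho>"
  have U_near: "U \<subseteq> cball (x0, w0) \<rho>1"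
  proof
    fix z assume "z \<in> U"
    then have "dist x0 (fst z) \<le> r" "dist w0 (snd z) \<le> \<rho>" by (auto simp: U_def)
    moreover have "dist (x0, w0) z \<le> dist x0 (fst z) + dist w0 (snd z)"
      by (simp add: dist_prod_def sqrt_sum_squares_le_sum)
    ultimately show "z \<in> cball (x0, w0) \<rho>1" using r \<rho> by simp
  qed
  define W where "W = norm w0 + \<rho>"
  define K where "K = kkt_constant TYPE('n) A W"
  have "K > 0" unfolding K_def using \<rho> by (intro kkt_constant_pos) (simp add: W_def)
  define N where "N = real DIM((real^'n) \<times> (real^'n))"
  have "N > 0" unfolding N_def by (simp add: DIM_positive del: DIM_prod)

  have "\<exists>\<delta>>0. \<forall>Q. C2_mpsc I J k Q \<and> C2_norm I J k (mpsc_diff P Q) x0 r \<le> \<delta> \<longrightarrow>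
      (\<exists>x\<in>cball x0 \<epsilon>. W_stationary I J k Q x \<and> (\<forall>y\<in>cball x0 r. W_stationary I J k Q y \<longrightarrow> y = x))"
    if "0 < \<epsilon>" "\<epsilon> \<le> r" for \<epsilon>
  proof -
    (* The three bounds are for the signs, for the value of the perturbed system at (x0, w0), and for
       the Lipschitz constant of the perturbation. *)
    define \<delta> where "\<delta> = min \<theta> (min (m / 2 * \<epsilon> / K) (m / 4 / (N * K)))"
    have \<delta>: "0 < \<delta>" "\<delta> \<le> \<theta>" "K * \<delta> \<le> m / 2 * \<epsilon>" "N * (K * \<delta>) \<le> m / 4"
    proof -
      show "0 < \<delta>" using \<open>\<theta> > 0\<close> \<open>m > 0\<close> \<open>K > 0\<close> \<open>N > 0\<close> \<open>0 < \<epsilon>\<close> by (simp add: \<delta>_def)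
      show "\<delta> \<le> \<theta>" by (simp add: \<delta>_def)
      have "\<delta> \<le> m / 2 * \<epsilon> / K" by (simp add: \<delta>_def)
      then have "\<delta> * K \<le> m / 2 * \<epsilon>"
        using \<open>K > 0\<close> by (simp only: pos_le_divide_eq)
      then show "K * \<delta> \<le> m / 2 * \<epsilon>" by (simp only: mult.commute)
      have "\<delta> \<le> m / 4 / (N * K)" by (simp add: \<delta>_def)
      then have "\<delta> * (N * K) \<le> m / 4"
        using mult_pos_pos[OF \<open>N > 0\<close> \<open>K > 0\<close>] by (simp only: pos_le_divide_eq)
      then show "N * (K * \<delta>) \<le> m / 4" by (simp add: mult_ac)
    qed
    have "\<exists>x\<in>cball x0 \<epsilon>. W_stationary I J k Q x \<and> (\<forall>y\<in>cball x0 r. W_stationary I J k Q y \<longrightarrow> y = x)"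
      if C2Qm: "C2_mpsc I J k Q" and small: "C2_norm I J k (mpsc_diff P Q) x0 r \<le> \<delta>" for Q
    proof -
      note C2Q = C2[OF C2Qm]
      have C2QA: "\<And>c. c \<in> A \<Longrightarrow> C2 (con_fun Q c)" using C2Q(2) subC by blast
      have C2diff: "C2_mpsc I J k (mpsc_diff P Q)"
        unfolding C2_mpsc_def components_conv
        by (auto simp: obj_mpsc_diff con_fun_mpsc_diff intro!: C2_diff C2P C2Q)
      have "C2_small_at \<delta> \<phi> x" if "\<phi> \<in> components I J k (mpsc_diff P Q)" "x \<in> cball x0 r" for \<phi> x
        by (rule C2_norm_le_imp_C2_small_at[OF fin C2diff small that])
      then have small_obj: "C2_small_at \<delta> (\<lambda>x. obj P x - obj Q x) x"
        and small_con: "\<And>c. c \<in> ?C \<Longrightarrow> C2_small_at \<delta> (\<lambda>x. con_fun P c x - con_fun Q c x) x"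
        if "x \<in> cball x0 r" for x
        using that unfolding components_conv by (auto simp flip: obj_mpsc_diff con_fun_mpsc_diff)
      define GQ where "GQ = kkt_system A a (obj Q) (con_fun Q)"
      define H where "H = kkt_map A a (\<lambda>x. obj P x - obj Q x) (\<lambda>c x. con_fun P c x - con_fun Q c x)"
      have H: "H z = G z - GQ z" for z
        unfolding H_def G_def GQ_def by (rule kkt_map_diff[OF C2P(1) C2Q(1) C2A C2QA])
      have W: "norm (snd z) \<le> W" if "z \<in> U" for z
      proof -
        have "norm (snd z - w0) \<le> \<rho>"
          using that by (auto simp: U_def dist_norm norm_minus_commute)
        then show ?thesis
          using norm_triangle_sub[of "snd z" w0] by (simp add: W_def)
      qed
      have fstU: "fst z \<in> cball x0 r" if "z \<in> U" for z using that by (auto simp: U_def)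
      have H_lip: "norm (H z - H z') \<le> m / 4 * norm (z - z')" if "z \<in> U" "z' \<in> U" for z z'
      proof -
        have "norm (H z - H z') \<le> N * (K * \<delta>) * norm (z - z')"
          unfolding N_def
        proof (rule lipschitz_from_derivative_on_Basis[OF _ _ _ that])
          show "convex U" unfolding U_def by (intro convex_Times convex_cball)
          show "(H has_derivative kkt_deriv A a (\<lambda>x. obj P x - obj Q x) (\<lambda>c x. con_fun P c x - con_fun Q c x) u) (at u)" for u
            unfolding H_def by (intro kkt_map_has_derivative C2_diff C2P C2Q C2A C2QA)
          show "norm (kkt_deriv A a (\<lambda>x. obj P x - obj Q x) (\<lambda>c x. con_fun P c x - con_fun Q c x) u b) \<le> K * \<delta>"
            if "u \<in> U" "b \<in> Basis" for u b
            unfolding K_def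
            by (rule norm_kkt_deriv_le[OF norm_a small_obj[OF fstU[OF that(1)]]
                  small_con[OF fstU[OF that(1)]] W[OF that(1)]])
               (use subC that(2) norm_Basis in auto)
        qed
        also have "\<dots> \<le> m / 4 * norm (z - z')"
          using \<delta>(4) by (intro mult_right_mono) auto
        finally show ?thesis .
      qed
      have near: "norm (GQ z - GQ z' - T (z - z')) \<le> m / 2 * norm (z - z')" if "z \<in> U" "z' \<in> U" for z z'
      proof -
        have "GQ z - GQ z' - T (z - z') = (G z - G z' - T (z - z')) - (H z - H z')"
          by (simp add: H algebra_simps)
        then have "norm (GQ z - GQ z' - T (z - z')) \<le> norm (G z - G z' - T (z - z')) + norm (H z - H z')"
          by (metis norm_triangle_ineq4)
        also have "\<dots> \<le> m / 4 * norm (z - z') + m / 4 * norm (z - z')"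
          by (intro add_mono \<rho>1 H_lip that subsetD[OF U_near])
        finally show ?thesis by (simp add: field_simps)
      qed
      have expand: "m / 2 * norm (z - z') \<le> norm (GQ z - GQ z')" if "z \<in> U" "z' \<in> U" for z z'
        using near_linear_expanding[where T = T, OF m near[OF that]] .
      have z0U: "(x0, w0) \<in> U" using r \<rho> by (simp add: U_def)
      have GQ0: "norm (GQ (x0, w0)) \<le> m / 2 * \<epsilon>"
      proof -
        have "norm (H (x0, w0)) \<le> K * \<delta>"
          unfolding H_def K_def
          by (rule norm_kkt_map_le)
             (use norm_a small_obj[OF fstU[OF z0U]] small_con[OF fstU[OF z0U]] W[OF z0U] subC in auto)
        then show ?thesis using \<delta>(3) by (simp add: H G0)
      qed
      have sign: "0 < con_fun P c x0 * con_fun Q c x" if "x \<in> cball x0 r" "c \<in> ?C" "c \<notin> A" for x c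
      proof -
        have "\<bar>con_fun P c x - con_fun P c x0\<bar> < \<theta>"
          using r1[of x c] that r by (simp add: dist_commute)
        moreover have "\<bar>con_fun P c x - con_fun Q c x\<bar> \<le> \<theta>"
          using small_con[OF that(1,2)] \<delta>(2) by (simp add: C2_small_at_def)
        ultimately have "\<bar>con_fun Q c x - con_fun P c x0\<bar> < \<bar>con_fun P c x0\<bar>"
          using \<theta>[of c] that by auto
        then show ?thesis by (auto simp: zero_less_mult_iff abs_if split: if_splits)
      qed
      have mult_sign: "0 < \<Lambda>0 c * (w \<bullet> a c)" if "w \<in> cball w0 \<rho>" "c \<in> A" "\<Lambda>0 c \<noteq> 0" for w c
      proof -
        have "\<bar>(w - w0) \<bullet> a c\<bar> \<le> norm (w - w0)"
          by (rule order_trans[OF Cauchy_Schwarz_ineq2 mult_left_le[OF norm_a[OF that(2)]]]) simp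
        also have "\<dots> \<le> \<rho>" using that(1) by (simp add: dist_norm norm_minus_commute)
        also have "\<dots> \<le> \<bar>\<Lambda>0 c\<bar> / 2" using \<rho>(3) \<rho>2[of c] that by simp
        also have "\<dots> < \<bar>\<Lambda>0 c\<bar>" using that(3) by simp
        finally have "\<bar>w \<bullet> a c - \<Lambda>0 c\<bar> < \<bar>\<Lambda>0 c\<bar>"
          by (simp add: inner_diff_left w0[OF that(2)])
        then show ?thesis by (auto simp: zero_less_mult_iff abs_if split: if_splits)
      qed
      have \<Lambda>0_Ineq: "0 < \<Lambda>0 (Ineq j)" if "Ineq j \<in> A" for j
        using ND2[of j] that by (simp add: \<Lambda>0_def A_def J0_def)
      have \<Lambda>0_Sw: "\<Lambda>0 (Sw1 i) \<noteq> 0 \<and> \<Lambda>0 (Sw2 i) \<noteq> 0" if "Sw1 i \<in> A" "Sw2 i \<in> A" for i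
        using ND3[of i] that by (auto simp: \<Lambda>0_def A_def beta_set_def)

      (* A zero of the perturbed system gives the stationary point. *)
      have ballU: "cball (x0, w0) \<epsilon> \<subseteq> U"
      proof
        fix z assume "z \<in> cball (x0, w0) \<epsilon>"
        then have "dist x0 (fst z) \<le> \<epsilon>" "dist w0 (snd z) \<le> \<epsilon>"
          using dist_fst_le[of "(x0, w0)" z] dist_snd_le[of "(x0, w0)" z] by auto
        then show "z \<in> U" using \<open>\<epsilon> \<le> r\<close> r \<rho> by (cases z) (simp add: U_def)
      qed
      have near_ball: "norm (GQ z - GQ z' - T (z - z')) \<le> m / 2 * norm (z - z')"
        if "z \<in> cball (x0, w0) \<epsilon>" "z' \<in> cball (x0, w0) \<epsilon>" for z z'
        by (intro near subsetD[OF ballU] that)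
      have "\<exists>z\<in>cball (x0, w0) \<epsilon>. GQ z = 0"
        using near_linear_zero_exists[where T = T and G = GQ, OF linT m \<open>m > 0\<close> near_ball _ GQ0]
          \<open>0 < \<epsilon>\<close> by simp
      then obtain x w where xw: "(x, w) \<in> cball (x0, w0) \<epsilon>" and zero: "GQ (x, w) = 0" by auto
      then have "x \<in> cball x0 \<epsilon>" using dist_fst_le[of "(x0, w0)" "(x, w)"] by auto
      have xwU: "(x, w) \<in> U" using xw ballU by blast
      then have xr: "x \<in> cball x0 r" and w\<rho>: "w \<in> cball w0 \<rho>" by (auto simp: U_def)
      have "W_stationary I J k Q x"
      proof (rule kkt_zero_imp_W_stationary[OF fin feas, where a = a and w = w, folded A_def])
        show "0 \<le> w \<bullet> a (Ineq j)" if "Ineq j \<in> A" for j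
          using mult_sign[OF w\<rho> that] \<Lambda>0_Ineq[OF that] by (simp add: zero_less_mult_iff)
      qed (use a sign[OF xr] zero in \<open>auto simp: GQ_def\<close>)
      (* Uniqueness among all stationary points in the large ball, with arbitrary multipliers. *)
      moreover have "y = x" if y: "y \<in> cball x0 r" and y_stat: "W_stationary I J k Q y" for y
      proof -
        obtain \<Lambda> where \<Lambda>: "W_multiplier I J k Q y \<Lambda>"
          using y_stat unfolding W_stationary_iff[OF fin] by blast
        define v where "v = (\<Sum>c\<in>A. \<Lambda> c *\<^sub>R a c)"
        have v: "v \<bullet> a c = \<Lambda> c" if "c \<in> A" for c
          unfolding v_def by (rule inner_sum_Basis_family[OF a that])
        have v_unused: "unused_coordinates A a v = 0" unfolding v_def by (rule unused_sum)
        have "grad (obj Q) y = (\<Sum>c\<in>A. \<Lambda> c *\<^sub>R grad (con_fun Q c) y)"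
          using W_multiplier_inactive[OF fin feas _ \<Lambda>, folded A_def] sign[OF y] by blast
        then have v_stat: "grad (obj Q) y = (\<Sum>c\<in>A. (v \<bullet> a c) *\<^sub>R grad (con_fun Q c) y)"
          by (simp add: v)
        have yw0U: "(y, w0) \<in> U" using y \<rho> by (simp add: U_def)
        have "v \<in> cball w0 \<rho>"
        proof (rule multiplier_near[OF _ _ \<rho>(1) v_stat v_unused])
          show "m / 2 > 0" using \<open>m > 0\<close> by simp
          show "unused_coordinates A a w0 = 0" unfolding w0_def by (rule unused_sum)
          show "m / 2 * norm (u - w0) \<le> norm (kkt_system A a (obj Q) (con_fun Q) (y, u) -
              kkt_system A a (obj Q) (con_fun Q) (y, w0))" if "u \<in> cball w0 \<rho>" for u
            using expand[of "(y, u)" "(y, w0)"] that y yw0U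
            by (simp add: U_def GQ_def norm_Pair)
          have "norm (GQ (y, w0) - GQ (x0, w0)) \<le> (B + m / 2) * r"
          proof -
            have "norm (GQ (y, w0) - GQ (x0, w0)) \<le> norm (T ((y, w0) - (x0, w0))) +
                norm (GQ (y, w0) - GQ (x0, w0) - T ((y, w0) - (x0, w0)))"
              by (metis norm_triangle_sub)
            also have "\<dots> \<le> B * norm ((y, w0) - (x0, w0)) + m / 2 * norm ((y, w0) - (x0, w0))"
              by (intro add_mono B near yw0U z0U)
            also have "\<dots> = (B + m / 2) * norm (y - x0)"
              by (simp add: norm_Pair distrib_right)
            also have "\<dots> \<le> (B + m / 2) * r"
              using y \<open>B + m / 2 > 0\<close> by (intro mult_left_mono) (auto simp: dist_norm norm_minus_commute)
            finally show ?thesis .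
          qed
          moreover have "m / 2 * \<epsilon> \<le> m / 2 * (\<rho> / 2)"
            using \<open>\<epsilon> \<le> r\<close> r(2) \<open>m > 0\<close> by (intro mult_left_mono) auto
          moreover have "norm (GQ (y, w0)) \<le> norm (GQ (x0, w0)) + norm (GQ (y, w0) - GQ (x0, w0))"
            by (rule norm_triangle_sub)
          ultimately have "norm (GQ (y, w0)) \<le> m / 2 * (\<rho> / 2) + m * \<rho> / 4"
            using GQ0 r(4) by linarith
          then show "norm (kkt_system A a (obj Q) (con_fun Q) (y, w0)) \<le> m / 2 * \<rho>"
            by (simp add: GQ_def mult.commute)
        qed
        have nz: "\<Lambda> c \<noteq> 0" if "c \<in> A" "\<Lambda>0 c \<noteq> 0" for c
          using mult_sign[OF \<open>v \<in> cball w0 \<rho>\<close> that] v[OF that(1)] by auto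
        have "con_fun Q c y = 0" if "c \<in> A" for c
        proof (rule W_multiplier_active[OF feas _ \<Lambda>, folded A_def])
          show "\<Lambda> (Ineq j) \<noteq> 0" if "Ineq j \<in> A" for j
            using nz[OF that] \<Lambda>0_Ineq[OF that] by auto
          show "\<Lambda> (Sw1 i) \<noteq> 0 \<and> \<Lambda> (Sw2 i) \<noteq> 0" if "Sw1 i \<in> A" "Sw2 i \<in> A" for i
            using nz[OF that(1)] nz[OF that(2)] \<Lambda>0_Sw[OF that] by auto
        qed (use that sign[OF y] in auto)
        then have "GQ (y, v) = 0"
          unfolding GQ_def kkt_system_eq_0_iff[OF a] using v_stat v_unused by blast
        moreover have "(y, v) \<in> U" using y \<open>v \<in> cball w0 \<rho>\<close> by (simp add: U_def)
        ultimately have "m / 2 * norm ((y, v) - (x, w)) \<le> 0"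
          using expand[OF _ xwU, of "(y, v)"] zero by simp
        then have "norm ((y, v) - (x, w)) \<le> 0"
          using \<open>m > 0\<close> by (simp add: mult_le_0_iff)
        then show "y = x" by (simp add: zero_prod_def)
      qed
      ultimately show ?thesis using \<open>x \<in> cball x0 \<epsilon>\<close> by blast
    qed
    with \<delta>(1) show ?thesis by blast
  qed
  moreover have "W_stationary I J k P x0"
    using mult unfolding W_stationary_iff[OF fin] by blast
  ultimately show ?thesis
    unfolding strongly_stable_def using r(1) by blast
qed

end
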